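(* Let $F=\sum_{m=1}^MF_m$, where each $F_m$ is boundedly Lipschitz with constants $L_m,D_m$ and $F$ is boundedly Lipschitz with constants $L,D$. Let $p_1,\dots,p_M>0$ with $\sum_{m=1}^Mp_m=1$. Let the iterates be generated by the extragradient method with importance sampling: $z^0=w^0\in\mathcal Z$ and, for $k=0,\dots,K-1$, $\eta_k$ is random with $\mathbb{P}(\eta_k=m)=p_m$, $\bar z^k=\tau z^k+(1-\tau)w^k$, $$z^{k+1/2}=\mathrm{prox}_{\gamma h}(\bar z^k-\gamma F(w^k)),\quad z^{k+1}=\mathrm{prox}_{\gamma h}\Big(\bar z^k-\frac{\gamma}{p_{\eta_k}}\big(F_{\eta_k}(z^{k+1/2})-F_{\eta_k}(w^k)\big)-\gamma F(w^k)\Big),$$ $w^{k+1}=z^{k+1}$ with probability $1-\tau$ and $w^{k+1}=w^k$ with probability $\tau$. Then: (i) in the strongly monotone case with $0<\gamma\le\min\left\{\frac{\sqrt{1-\tau}}{2\sqrt{2}\sqrt{\sum_{m=1}^M\frac{L_m^2}{p_m}}};\frac{1-\tau}{4(\mu_F+\mu_h)}\right\}$, $$\mathbb{E}\big[\tau\|z^K-z^*\|^2+\|w^K-z^*\|^2\big]\le\left(1-\gamma\cdot\frac{\mu_F+\mu_h}{16}\right)^{K-1}\big(\tau\|z^0-z^*\|^2+\|w^0-z^*\|^2\big)+\frac{32\gamma}{\mu_F+\mu_h}\sum_{m=1}^M\frac{D_m^2}{p_m};$$ (ii) in the monotone case with $0<\gamma\le\frac{\sqrt{1-\tau}}{2\sqrt{2L^2+4\sum_{m=1}^M\frac{L_m^2}{p_m}}}$,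 $$\mathbb{E}[\mathrm{Gap}(\hat z^K)]\le\frac{8\max_{u\in\mathcal C}\|z^0-u\|^2}{\gamma K}+\gamma\left(9\sum_{m=1}^M\frac{D_m^2}{p_m}+2D^2\right),\qquad\hat z^K=\frac1K\sum_{k=0}^{K-1}z^{k+1/2}.$$
   Context: An operator $G$ is boundedly Lipschitz with constants $L_G,D_G$ if $\|G(z_1)-G(z_2)\|^2\le L_G^2\|z_1-z_2\|^2+D_G^2$ for all $z_1,z_2\in\mathcal Z$. $h:\mathbb{R}^d\to\mathbb{R}\cup\{+\infty\}$ is proper, lower semicontinuous, convex; $F,F_m:\mathbb{R}^d\to\mathbb{R}^d$; $\mathcal Z\subseteq\mathbb{R}^d$ is nonempty, closed, convex, with $\mathrm{dom}\,h\subseteq\mathcal Z$; $\tau\in[0,1)$. $z^*\in\mathcal Z$ is a solution of the variational inequality $\langle F(z^* ),z-z^*\rangle+h(z)-h(z^* )\ge0$ for all $z\in\mathcal Z$. $\mathrm{prox}_{\gamma h}(z)=\arg\min_x\{\gamma h(x)+\frac12\|z-x\|^2\}$. Strongly monotone case: there are $\mu_F,\mu_h\ge0$ with $\mu_F+\mu_h>0$ such that for all $z_1,z_2\in\mathcal Z$: $\langle F(z_1)-F(z_2),z_1-z_2\rangle\ge\mu_F\|z_1-z_2\|^2$ and $h(z_1)-h(z_2)-\langle\nabla h(z_2),z_1-z_2\rangle\ge\frac{\mu_h}{2}\|z_1-z_2\|^2$ ($\nabla h$ denotes a subgradient). Monotone case: the same with $\mu_F=\mu_h=0$. $\mathrm{Gap}(z)=\max_{u\in\mathcal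 C}[\langle F(u),z-u\rangle+h(z)-h(u)]$, where $\mathcal C$ is a compact subset of $\mathcal Z$ containing $z^*$. $z^0$ is deterministic, $K\ge1$, and all random choices are made independently of everything generated before them. *)

theory Defs
  imports "HOL-Probability.Probability"
begin

definition boundedly_Lipschitz_on ::
  "'a::euclidean_space set \<Rightarrow> ('a \<Rightarrow> 'a) \<Rightarrow> real \<Rightarrow> real \<Rightarrow> bool" where
  "boundedly_Lipschitz_on Z G L D \<longleftrightarrow>
     (\<forall>z1\<in>Z. \<forall>z2\<in>Z. (norm (G z1 - G z2))\<^sup>2 \<le> L\<^sup>2 * (norm (z1 - z2))\<^sup>2 + D\<^sup>2)"

definition edom :: "('a \<Rightarrow> ereal) \<Rightarrow> 'a set" where
  "edom h = {x. h x < \<infinity>}"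

definition proper_fun :: "('a \<Rightarrow> ereal) \<Rightarrow> bool" where
  "proper_fun h \<longleftrightarrow> (\<forall>x. h x \<noteq> -\<infinity>) \<and> edom h \<noteq> {}"

definition lower_semicont :: "('a::topological_space \<Rightarrow> ereal) \<Rightarrow> bool" where
  "lower_semicont h \<longleftrightarrow> (\<forall>x. h x \<le> Liminf (at x) h)"

(* At t = 0 and t = 1 this uses the ereal convention 0 * \<infinity> = 0. *)
definition convex_fun :: "('a::real_vector \<Rightarrow> ereal) \<Rightarrow> bool" where
  "convex_fun h \<longleftrightarrow> (\<forall>x y. \<forall>t\<in>{0..1::real}.
     h ((1 - t) *\<^sub>R x + t *\<^sub>R y) \<le> ereal (1 - t) * h x + ereal t * h y)"

definition subdifferential :: "('a::euclidean_space \<Rightarrow> ereal) \<Rightarrow> 'a \<Rightarrow> 'a set" where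
  "subdifferential h x = {g. \<forall>y. h x + ereal (g \<bullet> (y - x)) \<le> h y}"

definition prox :: "real \<Rightarrow> ('a::euclidean_space \<Rightarrow> ereal) \<Rightarrow> 'a \<Rightarrow> 'a" where
  "prox \<gamma> h z = arg_min (\<lambda>x. ereal \<gamma> * h x + ereal (1 / 2 * (norm (z - x))\<^sup>2)) (\<lambda>x. True)"

definition VI_solution ::
  "'a::euclidean_space set \<Rightarrow> ('a \<Rightarrow> 'a) \<Rightarrow> ('a \<Rightarrow> ereal) \<Rightarrow> 'a \<Rightarrow> bool" where
  "VI_solution Z F h zs \<longleftrightarrow>
     zs \<in> Z \<and> (\<forall>z\<in>Z. ereal (F zs \<bullet> (z - zs)) + h z - h zs \<ge> 0)"

(* The inequality for h is required for every subgradient of h at z2. For a proper h there are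
   none at points where h is infinite, so h z2 is finite whenever the inequality applies. *)
definition strong_monotonicity ::
  "'a::euclidean_space set \<Rightarrow> ('a \<Rightarrow> 'a) \<Rightarrow> ('a \<Rightarrow> ereal) \<Rightarrow> real \<Rightarrow> real \<Rightarrow> bool" where
  "strong_monotonicity Z F h \<mu>F \<mu>h \<longleftrightarrow>
     (\<forall>z1\<in>Z. \<forall>z2\<in>Z. (F z1 - F z2) \<bullet> (z1 - z2) \<ge> \<mu>F * (norm (z1 - z2))\<^sup>2) \<and>
     (\<forall>z1\<in>Z. \<forall>z2\<in>Z. \<forall>g\<in>subdifferential h z2.
        h z1 - h z2 - ereal (g \<bullet> (z1 - z2)) \<ge> ereal (\<mu>h / 2 * (norm (z1 - z2))\<^sup>2))"

(* F and h are only assumed boundedly Lipschitz and lower semicontinuous, so the maximum in the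
   definition of the gap need not be attained; it is taken as a supremum. *)
definition Gap ::
  "'a::euclidean_space set \<Rightarrow> ('a \<Rightarrow> 'a) \<Rightarrow> ('a \<Rightarrow> ereal) \<Rightarrow> 'a \<Rightarrow> ereal" where
  "Gap C F h z = (SUP u\<in>C. ereal (F u \<bullet> (z - u)) + h z - h u)"

(* Independence of two random variables with values in countable types, possibly different ones
   (indep_var requires both to have the same type). *)
definition indep_discrete ::
  "'s measure \<Rightarrow> ('s \<Rightarrow> 'b::countable) \<Rightarrow> ('s \<Rightarrow> 'c::countable) \<Rightarrow> bool" where
  "indep_discrete P X Y \<longleftrightarrow>
     X \<in> measurable P (count_space UNIV) \<and> Y \<in> measurable P (count_space UNIV) \<and>
     prob_space.indep_set P (range (\<lambda>A. X -` A \<inter> space P)) (range (\<lambda>B. Y -` B \<inter> space P))"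

definition history :: "(nat \<Rightarrow> 's \<Rightarrow> nat) \<Rightarrow> (nat \<Rightarrow> 's \<Rightarrow> bool) \<Rightarrow> nat \<Rightarrow> 's \<Rightarrow> (nat \<times> bool) list" where
  "history \<eta> \<xi> k \<omega> = map (\<lambda>j. (\<eta> j \<omega>, \<xi> j \<omega>)) [0..<k]"

(* Step k draws the index \<eta> k, with law p on {1..M}, and then the coin \<xi> k, which decides whether
   w is updated. Since the starting point is deterministic, everything generated before step k is
   a function of the earlier indices and coins, i.e. of the history; the coin of step k is moreover
   independent of the index of step k. *)
definition random_choices ::
  "'s measure \<Rightarrow> nat \<Rightarrow> nat \<Rightarrow> (nat \<Rightarrow> real) \<Rightarrow> real \<Rightarrow> (nat \<Rightarrow> 's \<Rightarrow> nat) \<Rightarrow> (nat \<Rightarrow> 's \<Rightarrow> bool) \<Rightarrow> bool"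
  where
  "random_choices P K M p \<tau> \<eta> \<xi> \<longleftrightarrow> (\<forall>k<K.
     (\<forall>m\<in>{1..M}. measure P {\<omega>\<in>space P. \<eta> k \<omega> = m} = p m) \<and>
     measure P {\<omega>\<in>space P. \<xi> k \<omega>} = 1 - \<tau> \<and>
     indep_discrete P (\<eta> k) (history \<eta> \<xi> k) \<and>
     indep_discrete P (\<xi> k) (\<lambda>\<omega>. (history \<eta> \<xi> k \<omega>, \<eta> k \<omega>)))"

(* zh k stands for the half-step iterate with index k + 1/2. *)
definition extragradient_IS ::
  "'s measure \<Rightarrow> nat \<Rightarrow> (nat \<Rightarrow> real) \<Rightarrow> real \<Rightarrow> real \<Rightarrow> ('a::euclidean_space \<Rightarrow> ereal) \<Rightarrow>
   ('a \<Rightarrow> 'a) \<Rightarrow> (nat \<Rightarrow> 'a \<Rightarrow> 'a) \<Rightarrow> 'a \<Rightarrow> (nat \<Rightarrow> 's \<Rightarrow> nat) \<Rightarrow> (nat \<Rightarrow> 's \<Rightarrow> bool) \<Rightarrow>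
   (nat \<Rightarrow> 's \<Rightarrow> 'a) \<Rightarrow> (nat \<Rightarrow> 's \<Rightarrow> 'a) \<Rightarrow> (nat \<Rightarrow> 's \<Rightarrow> 'a) \<Rightarrow> bool" where
  "extragradient_IS P K p \<tau> \<gamma> h F Fm z0 \<eta> \<xi> z zh w \<longleftrightarrow>
     (\<forall>\<omega>\<in>space P. z 0 \<omega> = z0 \<and> w 0 \<omega> = z0 \<and>
       (\<forall>k<K. let zbar = \<tau> *\<^sub>R z k \<omega> + (1 - \<tau>) *\<^sub>R w k \<omega>; i = \<eta> k \<omega> in
          zh k \<omega> = prox \<gamma> h (zbar - \<gamma> *\<^sub>R F (w k \<omega>)) \<and>
          z (Suc k) \<omega> = prox \<gamma> h
            (zbar - (\<gamma> / p i) *\<^sub>R (Fm i (zh k \<omega>) - Fm i (w k \<omega>)) - \<gamma> *\<^sub>R F (w k \<omega>)) \<and>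
          w (Suc k) \<omega> = (if \<xi> k \<omega> then z (Suc k) \<omega> else w k \<omega>)))"

end

(* Summing the variational inequalities of the two proximal steps bounds the distance from z^{k+1} to
   any u by that of the averaged point, minus |z^{k+1/2} - w^k|^2 terms which absorb the variance of
   the sampled correction.

   In the strongly monotone case, taking u = z* and averaging over the choices of one step contracts
   V(z, w) = tau |z - z*|^2 + |w - z*|^2.

   In the monotone case the supremum over u has to be taken before the expectation. The terms that
   depend on both u and the random choices form the inner product of u - z^0 with a sum S of
   martingale differences, so 2 <S, u - z^0> <= |S|^2 / 4 + 4 |u - z^0|^2 separates them, and
   E |S|^2 is the sum of the variances of the increments, which the negative terms absorb again.
   All expectations reduce to averages over one step, since every iterate is a function of the
   history, which almost surely takes finitely many values. *)
theory Submission
  imports Defs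
begin

section \<open>Proximal points\<close>

text \<open>Two random effects depend on u. One is the sampling error of the correction, centred by
  subtracting \<open>F (half z w) - F w\<close>. The other is the coin: w jumps to z' or stays,
  while its mean is (1 - \<tau>) z' + \<tau> w, and this changes |w - u|^2 by an amount affine in u.
  Both are linear in u - c for the fixed point c = \<open>z0\<close>, so a single sum S collects
  them. The obstacle is the coin: its variance \<tau> (1 - \<tau>) |z' - w|^2 carries no factor
  \<gamma>^2, so a small step size does not control it. It has to be paid for by |y - z'|^2 and |y -
  w|^2, where y is the half step. For this reason half of |y - z'|^2 is saved in
  \<open>extragradient_step\<close>, and |S|^2 gets the weight 1/4, for which these terms suffice.
  The price is 4 |u - c|^2, on top of at most 2 |u - c|^2 from the start; division by 2 \<gamma> K
  turns the sum 6 into the factor 3. The one-step estimates are deterministic statements about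
  arbitrary lists of choices; probability enters only through \<open>choice_mean\<close>.\<close>

lemma lower_semicontD:
  assumes "lower_semicont h" "c < h x"
  shows "\<forall>\<^sub>F y in nhds x. c < h y"
proof -
  have "h x \<le> Liminf (at x) h"
    using assms(1) by (simp add: lower_semicont_def)
  then have "\<forall>\<^sub>F y in at x. c < h y"
    using assms(2) less_LiminfD[of c "at x" h] by (meson order_less_le_trans)
  then show ?thesis
    using assms(2) by (simp add: eventually_nhds_conv_at)
qed

lemma lower_semicontI:
  fixes h :: "'a::topological_space \<Rightarrow> ereal"
  assumes "\<And>x c. c < h x \<Longrightarrow> \<forall>\<^sub>F y in nhds x. c < h y"
  shows "lower_semicont h"
  unfolding lower_semicont_def le_Liminf_iff
  using assms eventually_nhds_conv_at by blast

text \<open>If every x in S had a better point \<open>s x\<close>, the superlevel sets strictly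
  above \<open>h (s x)\<close> would form an open cover of S. In a finite subcover the best of the
  points \<open>s x\<close> belongs to none of the chosen sets, although it lies in S.\<close>

lemma lower_semicont_attains_inf:
  fixes h :: "'a::topological_space \<Rightarrow> ereal"
  assumes lsc: "lower_semicont h" and "compact S" "S \<noteq> {}"
  obtains x where "x \<in> S" "\<And>y. y \<in> S \<Longrightarrow> h x \<le> h y"
proof -
  have "\<exists>x\<in>S. \<forall>y\<in>S. h x \<le> h y"
  proof (rule ccontr)
    assume "\<not> ?thesis"
    then have "\<forall>x\<in>S. \<exists>y\<in>S. h y < h x"
      by (auto simp: not_le)
    then obtain s where s: "\<And>x. x \<in> S \<Longrightarrow> s x \<in> S" "\<And>x. x \<in> S \<Longrightarrow> h (s x) < h x"
      by metis
    have "open {t. h (s x) < h t}" for x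
    proof (subst open_subopen, safe)
      fix t assume "h (s x) < h t"
      from lower_semicontD[OF lsc this] show "\<exists>T. open T \<and> t \<in> T \<and> T \<subseteq> {t. h (s x) < h t}"
        unfolding eventually_nhds by blast
    qed
    moreover have "S \<subseteq> (\<Union>x\<in>S. {t. h (s x) < h t})" using s(2) by blast
    ultimately obtain T where T: "T \<subseteq> S" "finite T" "S \<subseteq> (\<Union>x\<in>T. {t. h (s x) < h t})"
      using compactE_image[OF \<open>compact S\<close>, of S "\<lambda>x. {t. h (s x) < h t}"] by metis
    with \<open>S \<noteq> {}\<close> have "T \<noteq> {}" by auto
    obtain y where y: "y \<in> T" "\<And>x. x \<in> T \<Longrightarrow> h (s y) \<le> h (s x)"
      using ex_is_arg_min_if_finite[OF \<open>finite T\<close> \<open>T \<noteq> {}\<close>, of "\<lambda>x. h (s x)"]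
      by (auto simp: is_arg_min_linorder)
    then obtain x where "x \<in> T" "h (s x) < h (s y)"
      using T s(1)[of y] by blast
    then show False using y(2)[of x] by auto
  qed
  then show ?thesis using that by blast
qed

section \<open>Convex functions on their effective domain\<close>

lemma proper_fun_edom:
  assumes "proper_fun h" "x \<in> edom h"
  shows "h x = ereal (real_of_ereal (h x))"
  using assms by (cases "h x") (auto simp: proper_fun_def edom_def)

lemma proper_fun_edomE:
  assumes "proper_fun h" "x \<in> edom h"
  obtains r where "h x = ereal r"
  using proper_fun_edom[OF assms] that by blast

lemma convex_on_edom:
  assumes "proper_fun h" "convex_fun h"
  shows "convex_on (edom h) (\<lambda>x. real_of_ereal (h x))"
proof -
  have c: "(1 - t) *\<^sub>R x + t *\<^sub>R y \<in> edom h \<and> real_of_ereal (h ((1 - t) *\<^sub>R x + t *\<^sub>R y))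
       \<le> (1 - t) * real_of_ereal (h x) + t * real_of_ereal (h y)"
    if "x \<in> edom h" "y \<in> edom h" "0 \<le> t" "t \<le> 1" for x y t
  proof -
    let ?z = "(1 - t) *\<^sub>R x + t *\<^sub>R y"
    have le: "h ?z \<le> ereal (1 - t) * h x + ereal t * h y"
      using assms(2) that(3,4) by (auto simp: convex_fun_def)
    also have "\<dots> = ereal ((1 - t) * real_of_ereal (h x) + t * real_of_ereal (h y))"
      by (subst proper_fun_edom[OF assms(1) that(1)], subst proper_fun_edom[OF assms(1) that(2)]) simp
    finally have le: "h ?z \<le> ereal ((1 - t) * real_of_ereal (h x) + t * real_of_ereal (h y))" .
    then have d: "?z \<in> edom h"
      using order.strict_trans1[OF le, of \<infinity>] by (simp add: edom_def)
    from le show ?thesis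
      using d by (subst (asm) proper_fun_edom[OF assms(1) d]) simp
  qed
  have "convex (edom h)"
    unfolding convex_alt using c by simp
  then show ?thesis
    by (intro convex_onI) (use c in auto)
qed

text \<open>Let m be the minimum over the unit ball around \<open>x0\<close>, attained by
  semicontinuity. For x outside the ball, the segment from \<open>x0\<close> to x crosses the unit
  sphere at a point of value at least m, and convexity extrapolates this bound linearly outwards.
  The slope is therefore the drop from \<open>h x0\<close> to m.\<close>

lemma convex_fun_linear_minorant:
  fixes h :: "'a::euclidean_space \<Rightarrow> ereal"
  assumes "proper_fun h" "lower_semicont h" "convex_fun h" and x0: "x0 \<in> edom h"
  obtains m b where "0 \<le> b" "real_of_ereal (h x0) - m = b"
    "\<And>x. x \<in> edom h \<Longrightarrow> m - b * norm (x - x0) \<le> real_of_ereal (h x)"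
proof -
  let ?f = "\<lambda>x. real_of_ereal (h x)"
  obtain q where q: "q \<in> cball x0 1" "\<And>y. y \<in> cball x0 1 \<Longrightarrow> h q \<le> h y"
    using lower_semicont_attains_inf[OF assms(2) compact_cball, of x0 1] by auto
  have "q \<in> edom h"
    using q(2)[of x0] x0 by (auto simp: edom_def)
  have m: "?f q \<le> ?f y" if "y \<in> cball x0 1" "y \<in> edom h" for y
    using q(2)[OF that(1)] proper_fun_edomE[OF assms(1) that(2)] proper_fun_edomE[OF assms(1) \<open>q \<in> edom h\<close>]
    by (metis ereal_less_eq(3) real_of_ereal.simps(1))
  then have m0: "?f q \<le> ?f x0" using x0 by simp
  show ?thesis
  proof (rule that[of "?f x0 - ?f q" "?f q"])
    fix x assume x: "x \<in> edom h"
    let ?r = "norm (x - x0)"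
    show "?f q - (?f x0 - ?f q) * ?r \<le> ?f x"
    proof (cases "?r \<le> 1")
      case True
      then have "?f q \<le> ?f x" using m[of x] x by (simp add: dist_norm norm_minus_commute)
      moreover have "0 \<le> (?f x0 - ?f q) * ?r" using m0 by simp
      ultimately show ?thesis by linarith
    next
      case False
      define t where "t = 1 / ?r"
      define y where "y = (1 - t) *\<^sub>R x0 + t *\<^sub>R x"
      have t: "0 < t" "t \<le> 1" "t * ?r = 1" using False by (auto simp: t_def divide_simps)
      have y: "y = x0 + t *\<^sub>R (x - x0)" by (simp add: y_def algebra_simps)
      have "norm (y - x0) = t * ?r" using t by (simp add: y)
      then have "y \<in> cball x0 1" using t by (simp add: dist_norm norm_minus_commute)
      moreover have "y \<in> edom h"
        using convex_on_imp_convex[OF convex_on_edom[OF assms(1,3)]] x x0 t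
        unfolding y_def convex_alt by simp
      ultimately have "?f q \<le> ?f y" using m by blast
      also have "?f y \<le> (1 - t) * ?f x0 + t * ?f x"
        unfolding y_def using t x x0
        by (intro convex_onD[OF convex_on_edom[OF assms(1,3)]]) auto
      finally have "?f q * ?r \<le> ((1 - t) * ?f x0 + t * ?f x) * ?r"
        by (intro mult_right_mono) auto
      also have "\<dots> = (?r - t * ?r) * ?f x0 + t * ?r * ?f x" by (simp add: algebra_simps)
      also have "\<dots> = (?r - 1) * ?f x0 + ?f x" using t by simp
      finally show ?thesis using m0 by (simp add: algebra_simps)
    qed
  qed (use m0 in auto)
qed

text \<open>\<open>arg_min\<close> picks a minimizer by choice, so it suffices that one exists. The
  objective is lower semicontinuous, hence attains its minimum on a large ball around
  \<open>x0\<close>; outside that ball the quadratic outgrows the linear minorant of h, and the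
  objective is at least its value at \<open>x0\<close>.\<close>

lemma prox_is_arg_min:
  fixes h :: "'a::euclidean_space \<Rightarrow> ereal"
  assumes h: "proper_fun h" "lower_semicont h" "convex_fun h" and "\<gamma> > 0"
  shows "is_arg_min (\<lambda>x. ereal \<gamma> * h x + ereal (1 / 2 * (norm (v - x))\<^sup>2)) (\<lambda>x. True) (prox \<gamma> h v)"
proof -
  let ?f = "\<lambda>x. real_of_ereal (h x)"
  define \<phi> where "\<phi> x = ereal \<gamma> * h x + ereal (1 / 2 * (norm (v - x))\<^sup>2)" for x
  note real = proper_fun_edom[OF h(1)]
  obtain x0 where x0: "x0 \<in> edom h" using h(1) by (auto simp: proper_fun_def)
  obtain m b where mb: "0 \<le> b" "?f x0 - m = b" "\<And>x. x \<in> edom h \<Longrightarrow> m - b * norm (x - x0) \<le> ?f x"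
    using convex_fun_linear_minorant[OF h x0] by metis
  have \<phi>_edom: "\<phi> x = ereal (\<gamma> * ?f x + 1 / 2 * (norm (v - x))\<^sup>2)" if "x \<in> edom h" for x
    unfolding \<phi>_def by (subst real[OF that]) simp
  have \<phi>_out: "\<phi> x = \<infinity>" if "x \<notin> edom h" for x
    using that \<open>\<gamma> > 0\<close> by (simp add: \<phi>_def edom_def)
  have "lower_semicont \<phi>"
  proof (rule lower_semicontI)
    fix x c assume c: "c < \<phi> x"
    show "\<forall>\<^sub>F y in nhds x. c < \<phi> y"
    proof (cases c)
      case (real c')
      define q where "q = 1 / 2 * (norm (v - x))\<^sup>2"
      \<comment> \<open>A real level r strictly below \<open>h x\<close> separates the summands: h
        stays above r near x by semicontinuity, and the quadratic is continuous. This also covers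
        \<open>h x = \<infinity>\<close>.\<close>
      have "\<exists>r. ereal r < h x \<and> c' < \<gamma> * r + q"
      proof (cases "x \<in> edom h")
        case True
        then obtain a where a: "h x = ereal a" using proper_fun_edomE[OF h(1)] by blast
        then have "(c' - q) / \<gamma> < a"
          using c \<phi>_edom[OF True] real \<open>\<gamma> > 0\<close> by (simp add: field_simps q_def)
        then obtain r where "(c' - q) / \<gamma> < r" "r < a"
          using dense by blast
        then show ?thesis using \<open>\<gamma> > 0\<close> a by (intro exI[of _ r]) (simp add: field_simps)
      next
        case False
        then have "h x = \<infinity>" by (simp add: edom_def)
        then show ?thesis using \<open>\<gamma> > 0\<close>
          by (intro exI[of _ "(c' - q + 1) / \<gamma>"]) (simp add: field_simps)
      qed
      then obtain r where r: "ereal r < h x" "c' < \<gamma> * r + 1 / 2 * (norm (v - x))\<^sup>2"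
        unfolding q_def by blast
      have "((\<lambda>y. \<gamma> * r + 1 / 2 * (norm (v - y))\<^sup>2) \<longlongrightarrow> \<gamma> * r + 1 / 2 * (norm (v - x))\<^sup>2) (nhds x)"
        by (intro tendsto_intros filterlim_ident)
      then have "\<forall>\<^sub>F y in nhds x. c' < \<gamma> * r + 1 / 2 * (norm (v - y))\<^sup>2"
        by (rule order_tendstoD(1)) (rule r(2))
      moreover have "\<forall>\<^sub>F y in nhds x. ereal r < h y"
        by (rule lower_semicontD[OF h(2) r(1)])
      ultimately show ?thesis
      proof eventually_elim
        case (elim y)
        show ?case
        proof (cases "y \<in> edom h")
          case True
          then obtain a where a: "h y = ereal a" using proper_fun_edomE[OF h(1)] by blast
          then have "r \<le> ?f y" using elim(2) by simp
          then have "\<gamma> * r \<le> \<gamma> * ?f y" using \<open>\<gamma> > 0\<close> by simp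
          then show ?thesis using elim(1) by (simp add: real \<phi>_edom[OF True])
        qed (simp add: real \<phi>_out)
      qed
    next
      case MInf
      have "\<phi> y \<noteq> -\<infinity>" for y by (cases "y \<in> edom h") (auto simp: \<phi>_edom \<phi>_out)
      then show ?thesis unfolding MInf by (simp add: ereal_MInfty_lessI)
    qed (use c in auto)
  qed
  define d where "d = norm (v - x0)"
  \<comment> \<open>At distance r from \<open>x0\<close> the objective is at least \<gamma> (m - b
    r) + (r - d)^2 / 2. This is not below its value \<gamma> (m + b) + d^2 / 2 at \<open>x0\<close>
    once r (r - 2 (d + \<gamma> b)) \<ge> 2 \<gamma> b. The summand 1 in R makes the bracket at
    least 1, and r itself exceeds 2 \<gamma> b.\<close>
  define R where "R = 2 * (d + \<gamma> * b) + 1"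
  have db: "0 \<le> d" "0 \<le> \<gamma> * b" using mb(1) \<open>\<gamma> > 0\<close> by (auto simp: d_def)
  then have R: "0 < R" "d \<le> R" by (simp_all add: R_def)
  obtain q where q: "q \<in> cball x0 R" "\<And>y. y \<in> cball x0 R \<Longrightarrow> \<phi> q \<le> \<phi> y"
    using lower_semicont_attains_inf[OF \<open>lower_semicont \<phi>\<close> compact_cball, of x0 R] R by auto
  have "\<phi> q \<le> \<phi> y" for y
  proof (cases "y \<in> cball x0 R \<or> y \<notin> edom h")
    case True
    then show ?thesis using q \<phi>_out by auto
  next
    case False
    define r where "r = norm (y - x0)"
    have r: "r > R" using False by (simp add: r_def dist_norm norm_minus_commute)
    have "r \<le> norm (v - y) + d"
      unfolding r_def d_def using norm_triangle_ineq4[of "v - x0" "v - y"] by simp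
    then have "(r - d)\<^sup>2 \<le> (norm (v - y))\<^sup>2"
      using r R by (intro power_mono) auto
    moreover have "\<gamma> * (m - b * r) \<le> \<gamma> * ?f y"
      using mb(3)[of y] False \<open>\<gamma> > 0\<close> by (simp add: r_def)
    moreover have "\<gamma> * ?f x0 + 1 / 2 * d\<^sup>2 \<le> \<gamma> * (m - b * r) + 1 / 2 * (r - d)\<^sup>2"
    proof -
      define g where "g = \<gamma> * b"
      have g: "0 \<le> g" "2 * (d + g) + 1 < r" using r db by (simp_all add: R_def g_def)
      have "1 * r \<le> (r - 2 * (d + g)) * r" using g db by (intro mult_right_mono) auto
      then have "g + 1 / 2 * d\<^sup>2 \<le> 1 / 2 * (r - d)\<^sup>2 - g * r"
        using g db by (simp add: algebra_simps power2_eq_square)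
      moreover have "\<gamma> * ?f x0 = \<gamma> * m + g"
        unfolding g_def mb(2)[symmetric] by (simp add: right_diff_distrib)
      moreover have "\<gamma> * (m - b * r) = \<gamma> * m - g * r" by (simp add: g_def right_diff_distrib)
      ultimately show ?thesis by linarith
    qed
    ultimately have "\<phi> x0 \<le> \<phi> y"
      using False by (simp add: \<phi>_edom x0 d_def)
    moreover have "\<phi> q \<le> \<phi> x0" using q R by simp
    ultimately show ?thesis by simp
  qed
  then have "is_arg_min \<phi> (\<lambda>_. True) q" by (simp add: is_arg_min_linorder)
  then have "is_arg_min \<phi> (\<lambda>_. True) (SOME x. is_arg_min \<phi> (\<lambda>_. True) x)"
    by (rule someI[of "is_arg_min \<phi> (\<lambda>_. True)"])
  then show ?thesis
    unfolding prox_def arg_min_def \<phi>_def[abs_def] .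
qed

text \<open>First-order optimality without derivatives: compare the minimizer p with (1 - t) p + t
  u, use convexity of h, divide by t and let t tend to 0 from the right.\<close>

lemma
  fixes h :: "'a::euclidean_space \<Rightarrow> ereal"
  assumes h: "proper_fun h" "lower_semicont h" "convex_fun h" and "\<gamma> > 0"
  shows prox_in_edom: "prox \<gamma> h v \<in> edom h"
    and prox_variational: "u \<in> edom h \<Longrightarrow>
      (v - prox \<gamma> h v) \<bullet> (u - prox \<gamma> h v)
        \<le> \<gamma> * (real_of_ereal (h u) - real_of_ereal (h (prox \<gamma> h v)))"
proof -
  let ?f = "\<lambda>x. real_of_ereal (h x)" and ?p = "prox \<gamma> h v"
  have min: "ereal \<gamma> * h ?p + ereal (1 / 2 * (norm (v - ?p))\<^sup>2) \<le> ereal \<gamma> * h x + ereal (1 / 2 * (norm (v - x))\<^sup>2)" for x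
    using prox_is_arg_min[OF assms] by (simp add: is_arg_min_linorder)
  obtain x0 where x0: "x0 \<in> edom h" using h(1) by (auto simp: proper_fun_def)
  show p: "?p \<in> edom h"
  proof -
    obtain a where "h x0 = ereal a" using proper_fun_edomE[OF h(1) x0] by blast
    then show ?thesis using min[of x0] \<open>\<gamma> > 0\<close> by (cases "h ?p") (auto simp: edom_def)
  qed
  have min: "\<gamma> * ?f ?p + 1 / 2 * (norm (v - ?p))\<^sup>2 \<le> \<gamma> * ?f x + 1 / 2 * (norm (v - x))\<^sup>2" if x: "x \<in> edom h" for x
  proof -
    obtain a b where "h ?p = ereal a" "h x = ereal b"
      using proper_fun_edomE[OF h(1) p] proper_fun_edomE[OF h(1) x] by metis
    then show ?thesis using min[of x] by simp
  qed
  assume u: "u \<in> edom h"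
  let ?c = "(v - ?p) \<bullet> (u - ?p)"
  have ineq: "?c \<le> \<gamma> * (?f u - ?f ?p) + t / 2 * (norm (u - ?p))\<^sup>2" if t: "0 < t" "t < 1" for t
  proof -
    let ?x = "(1 - t) *\<^sub>R ?p + t *\<^sub>R u"
    note cv = convex_on_edom[OF h(1,3)]
    have x: "?x \<in> edom h" using convex_on_imp_convex[OF cv] p u t by (simp add: convex_alt)
    have e: "v - ?x = (v - ?p) - t *\<^sub>R (u - ?p)" by (simp add: algebra_simps)
    have n: "(norm (v - ?x))\<^sup>2 = (norm (v - ?p))\<^sup>2 - 2 * t * ?c + t\<^sup>2 * (norm (u - ?p))\<^sup>2"
      unfolding e using dot_norm_neg[of "v - ?p" "t *\<^sub>R (u - ?p)"] by (simp add: power_mult_distrib)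
    have "?f ?x \<le> (1 - t) * ?f ?p + t * ?f u"
      using t p u by (intro convex_onD[OF cv]) auto
    then have "\<gamma> * ?f ?x \<le> \<gamma> * ((1 - t) * ?f ?p + t * ?f u)" using \<open>\<gamma> > 0\<close> by simp
    with min[OF x] n have "t * ?c \<le> t * (\<gamma> * (?f u - ?f ?p) + t / 2 * (norm (u - ?p))\<^sup>2)"
      by (simp add: algebra_simps power2_eq_square)
    then show ?thesis using t by simp
  qed
  have "((\<lambda>t. \<gamma> * (?f u - ?f ?p) + t / 2 * (norm (u - ?p))\<^sup>2) \<longlongrightarrow> \<gamma> * (?f u - ?f ?p) + 0 / 2 * (norm (u - ?p))\<^sup>2) (at_right 0)"
    by (intro tendsto_intros) auto
  moreover have "\<forall>\<^sub>F t in at_right 0. ?c \<le> \<gamma> * (?f u - ?f ?p) + t / 2 * (norm (u - ?p))\<^sup>2"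
    using eventually_at_right_real[of 0 1, OF zero_less_one]
    by (rule eventually_mono) (metis greaterThanLessThan_iff ineq)
  ultimately have "?c \<le> \<gamma> * (?f u - ?f ?p) + 0 / 2 * (norm (u - ?p))\<^sup>2"
    by (rule tendsto_lowerbound) simp
  then show "?c \<le> \<gamma> * (?f u - ?f ?p)" by simp
qed

section \<open>Expectations along the history of random choices\<close>

lemma indep_discrete_prob:
  assumes "prob_space P" "indep_discrete P X Y"
  shows "measure P (X -` A \<inter> space P \<inter> (Y -` B \<inter> space P))
    = measure P (X -` A \<inter> space P) * measure P (Y -` B \<inter> space P)"
  using assms unfolding indep_discrete_def by (intro prob_space.indep_setD[OF assms(1)]) auto

text \<open>An almost surely finite range turns the expectation into a finite sum, so f may be an
  arbitrary real function.\<close>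

lemma (in prob_space)
  fixes f :: "'b::countable \<Rightarrow> real"
  assumes Y: "Y \<in> measurable M (count_space UNIV)" and B: "finite B" "AE \<omega> in M. Y \<omega> \<in> B"
  shows integrable_finite_range: "integrable M (\<lambda>\<omega>. f (Y \<omega>))"
    and integral_finite_range:
      "(\<integral>\<omega>. f (Y \<omega>) \<partial>M) = (\<Sum>b\<in>B. f b * prob (Y -` {b} \<inter> space M))"
proof -
  let ?g = "\<lambda>\<omega>. \<Sum>b\<in>B. f b * indicator (Y -` {b} \<inter> space M) \<omega>"
  have ev[measurable]: "Y -` {b} \<inter> space M \<in> sets M" for b
    using measurable_sets[OF Y] by simp
  have eq: "AE \<omega> in M. f (Y \<omega>) = ?g \<omega>"
    using B(2) AE_space
  proof eventually_elim
    case (elim \<omega>)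
    have "?g \<omega> = (\<Sum>b\<in>B. if b = Y \<omega> then f b else 0)"
      using elim(2) by (intro sum.cong) (auto simp: indicator_def)
    then show ?case using elim(1) B(1) by (simp add: sum.delta)
  qed
  have m: "(\<lambda>\<omega>. f (Y \<omega>)) \<in> borel_measurable M"
    using measurable_compose[OF Y, of f borel] by simp
  have g: "integrable M ?g" "integral\<^sup>L M ?g = (\<Sum>b\<in>B. f b * prob (Y -` {b} \<inter> space M))"
    by (auto simp: integrable_real_indicator emeasure_eq_measure)
  have m': "?g \<in> borel_measurable M" using g(1) by (rule borel_measurable_integrable)
  show "integrable M (\<lambda>\<omega>. f (Y \<omega>))"
    using integrable_cong_AE[OF m m' eq] g(1) by simp
  show "(\<integral>\<omega>. f (Y \<omega>) \<partial>M) = (\<Sum>b\<in>B. f b * prob (Y -` {b} \<inter> space M))"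
    using integral_cong_AE[OF m m' eq] g(2) by simp
qed

lemma measurable_count_space_Pair:
  fixes X :: "'s \<Rightarrow> 'b::countable" and Y :: "'s \<Rightarrow> 'c::countable"
  assumes "X \<in> measurable M (count_space UNIV)" "Y \<in> measurable M (count_space UNIV)"
  shows "(\<lambda>\<omega>. (X \<omega>, Y \<omega>)) \<in> measurable M (count_space UNIV)"
proof -
  have "(\<lambda>\<omega>. (X \<omega>, Y \<omega>)) -` {a} \<inter> space M = (X -` {fst a} \<inter> space M) \<inter> (Y -` {snd a} \<inter> space M)" for a
    by (cases a) auto
  then show ?thesis
    using assms by (auto simp: measurable_count_space_eq2_countable intro: measurable_sets)
qed

text \<open>Fubini for finite ranges: joint probabilities factor, and the double sum becomes an
  average over frozen values of X.\<close>

lemma indep_discrete_integral: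
  fixes g :: "'b::countable \<Rightarrow> 'c::countable \<Rightarrow> real"
  assumes P: "prob_space P" and XY: "indep_discrete P X Y"
    and A: "finite A" "AE \<omega> in P. X \<omega> \<in> A" and B: "finite B" "AE \<omega> in P. Y \<omega> \<in> B"
  shows "(\<integral>\<omega>. g (X \<omega>) (Y \<omega>) \<partial>P)
    = (\<Sum>a\<in>A. measure P (X -` {a} \<inter> space P) * (\<integral>\<omega>. g a (Y \<omega>) \<partial>P))"
proof -
  interpret prob_space P by (rule P)
  have m: "X \<in> measurable P (count_space UNIV)" "Y \<in> measurable P (count_space UNIV)"
    using XY by (auto simp: indep_discrete_def)
  have AB: "AE \<omega> in P. (X \<omega>, Y \<omega>) \<in> A \<times> B" using A(2) B(2) by eventually_elim auto
  have p: "prob ((\<lambda>\<omega>. (X \<omega>, Y \<omega>)) -` {(a, b)} \<inter> space P)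
      = prob (X -` {a} \<inter> space P) * prob (Y -` {b} \<inter> space P)" for a b
  proof -
    have "(\<lambda>\<omega>. (X \<omega>, Y \<omega>)) -` {(a, b)} \<inter> space P = X -` {a} \<inter> space P \<inter> (Y -` {b} \<inter> space P)"
      by auto
    then show ?thesis using indep_discrete_prob[OF P XY] by simp
  qed
  have "(\<integral>\<omega>. g (X \<omega>) (Y \<omega>) \<partial>P) = (\<integral>\<omega>. (case (X \<omega>, Y \<omega>) of (a, b) \<Rightarrow> g a b) \<partial>P)"
    by simp
  also have "\<dots> = (\<Sum>ab\<in>A \<times> B. (case ab of (a, b) \<Rightarrow> g a b) * prob ((\<lambda>\<omega>. (X \<omega>, Y \<omega>)) -` {ab} \<inter> space P))"
    by (rule integral_finite_range[OF measurable_count_space_Pair[OF m] _ AB]) (use A B in auto)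
  also have "\<dots> = (\<Sum>a\<in>A. \<Sum>b\<in>B. g a b * (prob (X -` {a} \<inter> space P) * prob (Y -` {b} \<inter> space P)))"
    unfolding sum.cartesian_product by (intro sum.cong) (auto simp: p)
  also have "\<dots> = (\<Sum>a\<in>A. prob (X -` {a} \<inter> space P) * (\<integral>\<omega>. g a (Y \<omega>) \<partial>P))"
    unfolding integral_finite_range[OF m(2) B] sum_distrib_left
    by (intro sum.cong refl) (simp add: mult_ac)
  finally show ?thesis .
qed

text \<open>The conditional expectation, given the history, of a function of the next index and
  coin, written as an explicit average.\<close>

definition choice_mean :: "nat \<Rightarrow> (nat \<Rightarrow> real) \<Rightarrow> real \<Rightarrow> (nat \<times> bool \<Rightarrow> real) \<Rightarrow> real" where
  "choice_mean M p \<tau> f = (\<Sum>m=1..M. p m * ((1 - \<tau>) * f (m, True) + \<tau> * f (m, False)))"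

lemma history_Suc: "history \<eta> \<xi> (Suc k) \<omega> = history \<eta> \<xi> k \<omega> @ [(\<eta> k \<omega>, \<xi> k \<omega>)]"
  by (simp add: history_def)

section \<open>Averages along the history\<close>

context
  fixes P :: "'s measure" and K M p \<tau> and \<eta> :: "nat \<Rightarrow> 's \<Rightarrow> nat" and \<xi>
  assumes P: "prob_space P" and choices: "random_choices P K M p \<tau> \<eta> \<xi>"
    and p_sum: "(\<Sum>m=1..M. p m) = 1"
begin

interpretation prob_space P by (rule P)

lemma measurable_choices:
  assumes "k < K"
  shows "\<eta> k \<in> measurable P (count_space UNIV)" "\<xi> k \<in> measurable P (count_space UNIV)"
  using choices assms by (auto simp: random_choices_def indep_discrete_def)

lemma measurable_history:
  "k \<le> K \<Longrightarrow> history \<eta> \<xi> k \<in> measurable P (count_space UNIV)"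
proof (induction k)
  case 0
  then show ?case by (simp add: history_def)
next
  case (Suc k)
  then have "(\<lambda>\<omega>. (history \<eta> \<xi> k \<omega>, \<eta> k \<omega>, \<xi> k \<omega>)) \<in> measurable P (count_space UNIV)"
    by (intro measurable_count_space_Pair measurable_choices) auto
  then have "(\<lambda>x. (\<lambda>(l, m, b). l @ [(m, b)]) (history \<eta> \<xi> k x, \<eta> k x, \<xi> k x)) \<in> measurable P (count_space UNIV)"
    by (rule measurable_compose) simp
  then show ?case by (simp add: history_Suc[abs_def])
qed

lemma prob_index: "k < K \<Longrightarrow> m \<in> {1..M} \<Longrightarrow> prob (\<eta> k -` {m} \<inter> space P) = p m"
proof -
  assume "k < K" "m \<in> {1..M}"
  moreover have "\<eta> k -` {m} \<inter> space P = {\<omega>\<in>space P. \<eta> k \<omega> = m}" by auto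
  ultimately show ?thesis using choices by (simp add: random_choices_def)
qed

lemma prob_coin:
  assumes "k < K"
  shows "prob (\<xi> k -` {True} \<inter> space P) = 1 - \<tau>" "prob (\<xi> k -` {False} \<inter> space P) = \<tau>"
proof -
  have "\<xi> k -` {True} \<inter> space P = {\<omega>\<in>space P. \<xi> k \<omega>}" by auto
  then show 1: "prob (\<xi> k -` {True} \<inter> space P) = 1 - \<tau>"
    using choices assms by (simp add: random_choices_def)
  have "\<xi> k -` {False} \<inter> space P = space P - \<xi> k -` {True} \<inter> space P" by auto
  then show "prob (\<xi> k -` {False} \<inter> space P) = \<tau>"
    using prob_compl[of "\<xi> k -` {True} \<inter> space P"] 1
      measurable_sets[OF measurable_choices(2)[OF assms], of "{True}"] by simp
qed

text \<open>The law of the index is prescribed only on {1..M}; the values \<open>p m\<close> add up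
  to 1 there, which leaves no mass elsewhere.\<close>

lemma AE_index: "k < K \<Longrightarrow> AE \<omega> in P. \<eta> k \<omega> \<in> {1..M}"
proof -
  assume k: "k < K"
  have s: "\<eta> k -` A \<inter> space P \<in> sets P" for A
    using measurable_sets[OF measurable_choices(1)[OF k]] by simp
  have "prob (\<Union>m\<in>{1..M}. \<eta> k -` {m} \<inter> space P) = (\<Sum>m=1..M. prob (\<eta> k -` {m} \<inter> space P))"
    by (intro finite_measure_finite_Union) (auto simp: disjoint_family_on_def s)
  also have "\<dots> = 1" using prob_index[OF k] p_sum by simp
  finally have "prob (\<Union>m\<in>{1..M}. \<eta> k -` {m} \<inter> space P) = 1" .
  moreover have "(\<Union>m\<in>{1..M}. \<eta> k -` {m} \<inter> space P) \<in> sets P"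
    by (intro sets.finite_UN) (auto intro: s)
  ultimately have "AE \<omega> in P. \<omega> \<in> (\<Union>m\<in>{1..M}. \<eta> k -` {m} \<inter> space P)"
    using prob_eq_1 by blast
  then show ?thesis by eventually_elim auto
qed

lemma AE_history:
  "k \<le> K \<Longrightarrow> AE \<omega> in P. history \<eta> \<xi> k \<omega> \<in> {l. set l \<subseteq> {1..M} \<times> UNIV \<and> length l = k}"
proof (induction k)
  case 0
  then show ?case by (simp add: history_def)
next
  case (Suc k)
  then have "AE \<omega> in P. history \<eta> \<xi> k \<omega> \<in> {l. set l \<subseteq> {1..M} \<times> UNIV \<and> length l = k}"
    "AE \<omega> in P. \<eta> k \<omega> \<in> {1..M}"
    using AE_index[of k] by auto
  then show ?case by eventually_elim (auto simp: history_Suc)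
qed

lemma finite_histories: "finite {l :: (nat \<times> bool) list. set l \<subseteq> {1..M} \<times> UNIV \<and> length l = k}"
  by (rule finite_lists_length_eq) simp

lemma integrable_history:
  fixes f :: "(nat \<times> bool) list \<Rightarrow> real"
  shows "k \<le> K \<Longrightarrow> integrable P (\<lambda>\<omega>. f (history \<eta> \<xi> k \<omega>))"
  by (rule integrable_finite_range[OF measurable_history finite_histories AE_history])

text \<open>The tower property. The coin is independent of the pair of history and index, so it is
  averaged out first; then the index is averaged out, being independent of the history.\<close>

lemma integral_history_Suc:
  fixes f :: "(nat \<times> bool) list \<Rightarrow> real"
  assumes k: "k < K"
  shows "(\<integral>\<omega>. f (history \<eta> \<xi> (Suc k) \<omega>) \<partial>P)
    = (\<integral>\<omega>. choice_mean M p \<tau> (\<lambda>x. f (history \<eta> \<xi> k \<omega> @ [x])) \<partial>P)"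
proof -
  have ind: "indep_discrete P (\<eta> k) (history \<eta> \<xi> k)"
    "indep_discrete P (\<xi> k) (\<lambda>\<omega>. (history \<eta> \<xi> k \<omega>, \<eta> k \<omega>))"
    using choices k by (auto simp: random_choices_def)
  let ?B = "{l :: (nat \<times> bool) list. set l \<subseteq> {1..M} \<times> UNIV \<and> length l = k}"
  have aeB: "AE \<omega> in P. history \<eta> \<xi> k \<omega> \<in> ?B" using AE_history[of k] k by simp
  then have aeBA: "AE \<omega> in P. (history \<eta> \<xi> k \<omega>, \<eta> k \<omega>) \<in> ?B \<times> {1..M}"
    using AE_index[OF k] by eventually_elim auto
  have fin: "finite (?B \<times> {1..M})" using finite_histories[of k] by simp
  have index: "(\<integral>\<omega>. f (history \<eta> \<xi> k \<omega> @ [(\<eta> k \<omega>, b)]) \<partial>P)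
    = (\<Sum>m=1..M. p m * (\<integral>\<omega>. f (history \<eta> \<xi> k \<omega> @ [(m, b)]) \<partial>P))" for b
    using indep_discrete_integral[OF P ind(1) _ AE_index[OF k] finite_histories aeB, of "\<lambda>m l. f (l @ [(m, b)])"]
    by (simp add: prob_index[OF k])
  have "(\<integral>\<omega>. f (history \<eta> \<xi> (Suc k) \<omega>) \<partial>P)
    = (\<Sum>b\<in>UNIV. prob (\<xi> k -` {b} \<inter> space P) * (\<integral>\<omega>. f (history \<eta> \<xi> k \<omega> @ [(\<eta> k \<omega>, b)]) \<partial>P))"
    using indep_discrete_integral[OF P ind(2) _ _ fin aeBA, of UNIV "\<lambda>b (l, m). f (l @ [(m, b)])"]
    by (simp add: history_Suc)
  also have "\<dots> = (\<Sum>m=1..M. p m * ((1 - \<tau>) * (\<integral>\<omega>. f (history \<eta> \<xi> k \<omega> @ [(m, True)]) \<partial>P)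
      + \<tau> * (\<integral>\<omega>. f (history \<eta> \<xi> k \<omega> @ [(m, False)]) \<partial>P)))"
    unfolding UNIV_bool
    by (simp add: prob_coin[OF k] index sum_distrib_left flip: sum.distrib)
      (intro sum.cong refl, simp add: algebra_simps)
  also have "\<dots> = (\<integral>\<omega>. choice_mean M p \<tau> (\<lambda>x. f (history \<eta> \<xi> k \<omega> @ [x])) \<partial>P)"
  proof -
    have i: "integrable P (\<lambda>\<omega>. f (history \<eta> \<xi> k \<omega> @ [x]))" for x
      using integrable_history[of k "\<lambda>l. f (l @ [x])"] k by simp
    show ?thesis
      unfolding choice_mean_def
      by (subst Bochner_Integration.integral_sum) (use i in auto)
  qed
  finally show ?thesis .
qed

text \<open>A discrete Gronwall bound serving both cases: with a < 1 for the Lyapunov function,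
  where the errors form a geometric series, and with a = 1 for the potential, where they add up
  linearly.\<close>

lemma integral_history_contraction:
  fixes f :: "(nat \<times> bool) list \<Rightarrow> real"
  assumes step: "\<And>l. choice_mean M p \<tau> (\<lambda>x. f (l @ [x])) \<le> a * f l + d" and "0 \<le> a"
  shows "k \<le> K \<Longrightarrow> (\<integral>\<omega>. f (history \<eta> \<xi> k \<omega>) \<partial>P) \<le> a ^ k * f [] + d * (\<Sum>j<k. a ^ j)"
proof (induction k)
  case 0
  then show ?case by (simp add: history_def prob_space)
next
  case (Suc k)
  let ?E = "\<integral>\<omega>. f (history \<eta> \<xi> k \<omega>) \<partial>P"
  have "(\<integral>\<omega>. f (history \<eta> \<xi> (Suc k) \<omega>) \<partial>P) \<le> (\<integral>\<omega>. a * f (history \<eta> \<xi> k \<omega>) + d \<partial>P)"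
  proof -
    have "(\<integral>\<omega>. choice_mean M p \<tau> (\<lambda>x. f (history \<eta> \<xi> k \<omega> @ [x])) \<partial>P)
        \<le> (\<integral>\<omega>. a * f (history \<eta> \<xi> k \<omega>) + d \<partial>P)"
    proof (rule integral_mono)
      show "integrable P (\<lambda>\<omega>. choice_mean M p \<tau> (\<lambda>x. f (history \<eta> \<xi> k \<omega> @ [x])))"
        using integrable_history[of k "\<lambda>l. choice_mean M p \<tau> (\<lambda>x. f (l @ [x]))"] Suc.prems by simp
      show "integrable P (\<lambda>\<omega>. a * f (history \<eta> \<xi> k \<omega>) + d)"
        using integrable_history[of k "\<lambda>l. a * f l + d"] Suc.prems by simp
    qed (rule step)
    then show ?thesis using integral_history_Suc[of k f] Suc.prems by simp
  qed
  also have "\<dots> = a * ?E + d"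
    using Suc.prems integrable_history[of k f] by (simp add: prob_space)
  also have "\<dots> \<le> a * (a ^ k * f [] + d * (\<Sum>j<k. a ^ j)) + d"
    using Suc \<open>0 \<le> a\<close> by (simp add: mult_left_mono)
  also have "\<dots> = a ^ Suc k * f [] + d * (\<Sum>j<Suc k. a ^ j)"
    by (subst sum.lessThan_Suc_shift) (simp add: algebra_simps sum_distrib_left)
  finally show ?case .
qed

end

section \<open>One step of the extragradient method\<close>

text \<open>The polarization identity for v and for w, weighted by t and 1 - t; the weights add up
  to 1, which merges the two copies of |u - x|^2.\<close>

lemma inner_convex_combination:
  fixes x u v w :: "'a::real_inner"
  shows "2 * ((t *\<^sub>R v + (1 - t) *\<^sub>R w - x) \<bullet> (u - x))
    = t * (norm (v - x))\<^sup>2 + (1 - t) * (norm (w - x))\<^sup>2 + (norm (u - x))\<^sup>2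
      - t * (norm (v - u))\<^sup>2 - (1 - t) * (norm (w - u))\<^sup>2"
proof -
  have c: "t *\<^sub>R v + (1 - t) *\<^sub>R w - x = t *\<^sub>R (v - x) + (1 - t) *\<^sub>R (w - x)"
    by (simp add: algebra_simps)
  have "2 * ((y - x) \<bullet> (u - x)) = (norm (y - x))\<^sup>2 + (norm (u - x))\<^sup>2 - (norm (y - u))\<^sup>2" for y
    using dot_norm_neg[of "y - x" "u - x"] by simp
  from this[of v] this[of w] show ?thesis
    unfolding c inner_add_left inner_scaleR_left by (simp add: algebra_simps) algebra
qed

lemma norm_diff_square_le:
  fixes a b c :: "'a::real_inner"
  shows "(norm (a - c))\<^sup>2 \<le> 2 * (norm (b - a))\<^sup>2 + 2 * (norm (b - c))\<^sup>2"
proof -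
  have "(norm ((b - c) - (b - a)))\<^sup>2 + (norm ((b - c) + (b - a)))\<^sup>2
    = 2 * (norm (b - c))\<^sup>2 + 2 * (norm (b - a))\<^sup>2"
    by (simp add: power2_norm_eq_inner inner_add inner_diff)
  moreover have "(norm ((b - c) - (b - a)))\<^sup>2 = (norm (a - c))\<^sup>2" by simp
  moreover have "0 \<le> (norm ((b - c) + (b - a)))\<^sup>2" by simp
  ultimately show ?thesis by argo
qed

section \<open>The importance-sampled correction and the proximal inequalities\<close>

locale extragradient_problem =
  fixes h :: "'a::euclidean_space \<Rightarrow> ereal" and F :: "'a \<Rightarrow> 'a" and Fm :: "nat \<Rightarrow> 'a \<Rightarrow> 'a"
    and Z :: "'a set" and M :: nat and p Lm Dm :: "nat \<Rightarrow> real" and \<tau> \<gamma> :: real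
  assumes h: "proper_fun h" "lower_semicont h" "convex_fun h" and dom: "edom h \<subseteq> Z"
    and \<tau>: "0 \<le> \<tau>" "\<tau> < 1" and \<gamma>: "0 < \<gamma>"
    and F_sum: "\<And>x. F x = (\<Sum>m=1..M. Fm m x)"
    and Fm_Lipschitz: "\<And>m. m \<in> {1..M} \<Longrightarrow> boundedly_Lipschitz_on Z (Fm m) (Lm m) (Dm m)"
    and p_pos: "\<And>m. m \<in> {1..M} \<Longrightarrow> 0 < p m" and p_sum: "(\<Sum>m=1..M. p m) = 1"
begin

abbreviation hr :: "'a \<Rightarrow> real" where "hr x \<equiv> real_of_ereal (h x)"

definition half :: "'a \<Rightarrow> 'a \<Rightarrow> 'a" where
  "half z w = prox \<gamma> h (\<tau> *\<^sub>R z + (1 - \<tau>) *\<^sub>R w - \<gamma> *\<^sub>R F w)"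

definition full :: "nat \<Rightarrow> 'a \<Rightarrow> 'a \<Rightarrow> 'a" where
  "full m z w = prox \<gamma> h (\<tau> *\<^sub>R z + (1 - \<tau>) *\<^sub>R w
     - (\<gamma> / p m) *\<^sub>R (Fm m (half z w) - Fm m w) - \<gamma> *\<^sub>R F w)"

definition correction :: "nat \<Rightarrow> 'a \<Rightarrow> 'a \<Rightarrow> 'a" where
  "correction m z w = (1 / p m) *\<^sub>R (Fm m (half z w) - Fm m w)"

text \<open>In the second moment of \<open>correction\<close> the importance weights enter as p m (1
  / p m)^2 = 1 / p m; this is where the weighted sums of squared constants come from.\<close>

definition Lip2 :: real where "Lip2 = (\<Sum>m=1..M. (Lm m)\<^sup>2 / p m)"

definition Dev2 :: real where "Dev2 = (\<Sum>m=1..M. (Dm m)\<^sup>2 / p m)"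

lemma half_in_edom: "half z w \<in> edom h"
  and full_in_edom: "full m z w \<in> edom h"
  unfolding half_def full_def by (rule prox_in_edom[OF h \<gamma>])+

lemma half_in_Z: "half z w \<in> Z"
  and full_in_Z: "full m z w \<in> Z"
  using half_in_edom full_in_edom dom by blast+

lemma Dev2_nonneg: "0 \<le> Dev2" and Lip2_nonneg: "0 \<le> Lip2"
  unfolding Dev2_def Lip2_def by (auto intro!: sum_nonneg divide_nonneg_pos p_pos)

lemma mean_correction: "(\<Sum>m=1..M. p m *\<^sub>R correction m z w) = F (half z w) - F w"
proof -
  have "(\<Sum>m=1..M. p m *\<^sub>R correction m z w) = (\<Sum>m=1..M. Fm m (half z w) - Fm m w)"
    using p_pos by (intro sum.cong) (auto simp: correction_def less_imp_neq[symmetric])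
  then show ?thesis by (simp add: F_sum sum_subtractf)
qed

lemma mean_square_correction:
  assumes "w \<in> Z"
  shows "(\<Sum>m=1..M. p m * (norm (correction m z w))\<^sup>2) \<le> Lip2 * (norm (half z w - w))\<^sup>2 + Dev2"
proof -
  have "(\<Sum>m=1..M. p m * (norm (correction m z w))\<^sup>2)
      \<le> (\<Sum>m=1..M. ((Lm m)\<^sup>2 * (norm (half z w - w))\<^sup>2 + (Dm m)\<^sup>2) / p m)"
  proof (rule sum_mono)
    fix m assume m: "m \<in> {1..M}"
    have "p m * (norm (correction m z w))\<^sup>2 = (norm (Fm m (half z w) - Fm m w))\<^sup>2 / p m"
      using p_pos[OF m] by (simp add: correction_def power_mult_distrib power_divide power2_eq_square)
    also have "\<dots> \<le> ((Lm m)\<^sup>2 * (norm (half z w - w))\<^sup>2 + (Dm m)\<^sup>2) / p m"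
      using Fm_Lipschitz[OF m] p_pos[OF m] half_in_Z assms
      by (intro divide_right_mono) (auto simp: boundedly_Lipschitz_on_def)
    finally show "p m * (norm (correction m z w))\<^sup>2
      \<le> ((Lm m)\<^sup>2 * (norm (half z w - w))\<^sup>2 + (Dm m)\<^sup>2) / p m" .
  qed
  also have "\<dots> = Lip2 * (norm (half z w - w))\<^sup>2 + Dev2"
    by (simp add: Lip2_def Dev2_def add_divide_distrib sum.distrib sum_distrib_right)
  finally show ?thesis .
qed

text \<open>Test the full step with u and the half step with the full step z'. Both start from the
  same averaged point, so the distances from z and w to z' cancel in the sum, and so do the values
  of h at z'.\<close>

lemma extragradient_step:
  fixes z w m
  defines "y \<equiv> half z w" and "z' \<equiv> full m z w" and "d \<equiv> correction m z w"
  assumes u: "u \<in> edom h"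
  shows "2 * \<gamma> * ((d + F w) \<bullet> (y - u) + hr y - hr u)
    \<le> \<tau> * (norm (z - u))\<^sup>2 + (1 - \<tau>) * (norm (w - u))\<^sup>2 - (norm (z' - u))\<^sup>2
      - 1 / 2 * (norm (y - z'))\<^sup>2 - \<tau> * (norm (y - z))\<^sup>2 - (1 - \<tau>) * (norm (y - w))\<^sup>2
      + 2 * \<gamma>\<^sup>2 * (norm d)\<^sup>2"
proof -
  define b where "b = \<tau> *\<^sub>R z + (1 - \<tau>) *\<^sub>R w"
  have y: "y = prox \<gamma> h (b - \<gamma> *\<^sub>R F w)" by (simp add: y_def half_def b_def)
  have "z' = prox \<gamma> h (b - \<gamma> *\<^sub>R d - \<gamma> *\<^sub>R F w)"
    by (simp add: z'_def full_def d_def correction_def b_def)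
  then have 1: "(b - \<gamma> *\<^sub>R d - \<gamma> *\<^sub>R F w - z') \<bullet> (u - z') \<le> \<gamma> * (hr u - hr z')"
    using prox_variational[OF h \<gamma> u] by simp
  have 2: "(b - \<gamma> *\<^sub>R F w - y) \<bullet> (z' - y) \<le> \<gamma> * (hr z' - hr y)"
    unfolding y using prox_variational[OF h \<gamma> full_in_edom] by (simp add: z'_def)
  \<comment> \<open>Young's inequality, as half the square of 2 \<gamma> d - (y - z'). It spends
    only half of |y - z'|^2; the rest pays for the coin variance in the monotone case.\<close>
  have 3: "0 \<le> 1 / 2 * (norm (y - z'))\<^sup>2 - 2 * (\<gamma> * (d \<bullet> (y - z'))) + 2 * \<gamma>\<^sup>2 * (norm d)\<^sup>2"
  proof -
    define t where "t = (norm ((2 * \<gamma>) *\<^sub>R d - (y - z')))\<^sup>2"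
    then have "0 \<le> t" by simp
    then show ?thesis
      using dot_norm_neg[of "(2 * \<gamma>) *\<^sub>R d" "y - z'"]
      unfolding t_def[symmetric] by (simp add: power_mult_distrib)
  qed
  have e1: "(b - \<gamma> *\<^sub>R d - \<gamma> *\<^sub>R F w - z') \<bullet> (u - z') = (b - z') \<bullet> (u - z')
     + \<gamma> * ((d + F w) \<bullet> (y - u)) - \<gamma> * (d \<bullet> (y - z')) + \<gamma> * (F w \<bullet> (z' - y))"
    by (simp add: inner_diff_left inner_diff_right inner_add_left algebra_simps)
  have e2: "(b - \<gamma> *\<^sub>R F w - y) \<bullet> (z' - y) = (b - y) \<bullet> (z' - y) - \<gamma> * (F w \<bullet> (z' - y))"
    by (simp add: inner_diff_left algebra_simps)
  show ?thesis
    using 1 2 3 inner_convex_combination[of \<tau> z w z' u] inner_convex_combination[of \<tau> z w y z']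
    unfolding e1 e2 b_def[symmetric] norm_minus_commute[of u z'] norm_minus_commute[of z' y]
      norm_minus_commute[of z y] norm_minus_commute[of w y]
    by (simp add: algebra_simps)
qed

text \<open>The half step y does not depend on the sampled index, so averaging replaces the
  correction by F y - F w. Together with F w this leaves F y in the regret term.\<close>

lemma mean_extragradient_step:
  fixes z w
  defines "y \<equiv> half z w"
  assumes u: "u \<in> edom h" and w: "w \<in> Z"
  shows "(\<Sum>m=1..M. p m * (norm (full m z w - u))\<^sup>2)
    \<le> \<tau> * (norm (z - u))\<^sup>2 + (1 - \<tau>) * (norm (w - u))\<^sup>2
      - \<tau> * (norm (y - z))\<^sup>2 - (1 - \<tau>) * (norm (y - w))\<^sup>2
      + 2 * \<gamma>\<^sup>2 * (Lip2 * (norm (y - w))\<^sup>2 + Dev2) - 2 * \<gamma> * (F y \<bullet> (y - u) + hr y - hr u)"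
proof -
  define c where "c = \<tau> * (norm (z - u))\<^sup>2 + (1 - \<tau>) * (norm (w - u))\<^sup>2
      - \<tau> * (norm (y - z))\<^sup>2 - (1 - \<tau>) * (norm (y - w))\<^sup>2 - 2 * \<gamma> * (F w \<bullet> (y - u) + hr y - hr u)"
  have "(\<Sum>m=1..M. p m * (norm (full m z w - u))\<^sup>2)
    \<le> (\<Sum>m=1..M. p m * (c + 2 * \<gamma>\<^sup>2 * (norm (correction m z w))\<^sup>2 - 2 * \<gamma> * (correction m z w \<bullet> (y - u))))"
  proof (intro sum_mono mult_left_mono)
    fix m
    define t where "t = (norm (half z w - full m z w))\<^sup>2"
    then have "0 \<le> t" by simp
    then show "(norm (full m z w - u))\<^sup>2
      \<le> c + 2 * \<gamma>\<^sup>2 * (norm (correction m z w))\<^sup>2 - 2 * \<gamma> * (correction m z w \<bullet> (y - u))"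
      using extragradient_step[OF u, of m z w]
      unfolding c_def y_def inner_add_left t_def[symmetric] by (simp add: algebra_simps)
  qed (use p_pos in \<open>auto intro: less_imp_le\<close>)
  also have "\<dots> = c * (\<Sum>m=1..M. p m) + 2 * \<gamma>\<^sup>2 * (\<Sum>m=1..M. p m * (norm (correction m z w))\<^sup>2)
      - 2 * \<gamma> * ((\<Sum>m=1..M. p m *\<^sub>R correction m z w) \<bullet> (y - u))"
    by (simp add: sum_distrib_left inner_sum_left algebra_simps sum.distrib sum_subtractf)
  also have "\<dots> = c + 2 * \<gamma>\<^sup>2 * (\<Sum>m=1..M. p m * (norm (correction m z w))\<^sup>2)
      - 2 * \<gamma> * ((F y - F w) \<bullet> (y - u))"
    unfolding mean_correction y_def p_sum by simp
  also have "\<dots> \<le> c + 2 * \<gamma>\<^sup>2 * (Lip2 * (norm (y - w))\<^sup>2 + Dev2) - 2 * \<gamma> * ((F y - F w) \<bullet> (y - u))"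
    using mult_left_mono[OF mean_square_correction[OF w, of z], of "2 * \<gamma>\<^sup>2"] by (simp add: y_def)
  finally show ?thesis
    unfolding c_def inner_diff_left by (simp add: algebra_simps)
qed

section \<open>Contraction in the strongly monotone case\<close>

lemma VI_solution_in_edom:
  assumes "VI_solution Z F h zs"
  shows "zs \<in> edom h"
proof -
  obtain x where x: "x \<in> edom h" using h(1) by (auto simp: proper_fun_def)
  then obtain r where "h x = ereal r" using proper_fun_edomE[OF h(1)] by blast
  moreover have "0 \<le> ereal (F zs \<bullet> (x - zs)) + h x - h zs"
    using assms x dom by (auto simp: VI_solution_def)
  ultimately show ?thesis by (cases "h zs") (auto simp: edom_def)
qed

text \<open>The variational inequality makes \<open>- F zs\<close> a subgradient of h at
  \<open>zs\<close>, which is where the strong convexity of h can be applied. The terms with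
  \<open>F zs\<close> then cancel against those from the strong monotonicity of F.\<close>

lemma VI_solution_strong_monotonicity:
  assumes sol: "VI_solution Z F h zs" and sm: "strong_monotonicity Z F h \<mu>F \<mu>h" and y: "y \<in> edom h"
  shows "(\<mu>F + \<mu>h / 2) * (norm (y - zs))\<^sup>2 \<le> F y \<bullet> (y - zs) + hr y - hr zs"
proof -
  have zs: "zs \<in> edom h" by (rule VI_solution_in_edom[OF sol])
  obtain r s where rs: "h zs = ereal r" "h y = ereal s"
    using proper_fun_edomE[OF h(1) zs] proper_fun_edomE[OF h(1) y] by metis
  have "- F zs \<in> subdifferential h zs"
    unfolding subdifferential_def
  proof safe
    fix x
    show "h zs + ereal (- F zs \<bullet> (x - zs)) \<le> h x"
    proof (cases "x \<in> edom h")
      case True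
      then obtain t where "h x = ereal t" using proper_fun_edomE[OF h(1)] by blast
      moreover have "ereal (F zs \<bullet> (x - zs)) + h x - h zs \<ge> 0"
        using sol True dom by (auto simp: VI_solution_def)
      ultimately show ?thesis using rs by simp
    qed (simp add: edom_def)
  qed
  then have "h y - h zs - ereal (- F zs \<bullet> (y - zs)) \<ge> ereal (\<mu>h / 2 * (norm (y - zs))\<^sup>2)"
    using sm y zs dom unfolding strong_monotonicity_def by blast
  then have "\<mu>h / 2 * (norm (y - zs))\<^sup>2 \<le> s - r + F zs \<bullet> (y - zs)"
    using rs by simp
  moreover have "\<mu>F * (norm (y - zs))\<^sup>2 \<le> (F y - F zs) \<bullet> (y - zs)"
    using sm y zs dom unfolding strong_monotonicity_def by blast
  ultimately show ?thesis using rs by (simp add: inner_diff_left algebra_simps)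
qed

text \<open>Averaging the coin turns |w' - zs|^2 into (1 - \<tau>) |z' - zs|^2 + \<tau> |w - zs|^2.
  The weight \<tau> on the first part of the Lyapunov function is the one that completes the
  coefficient of |z' - zs|^2 to 1, as \<open>mean_extragradient_step\<close> requires.\<close>

lemma choice_mean_Lyapunov:
  assumes sol: "VI_solution Z F h zs" and sm: "strong_monotonicity Z F h \<mu>F \<mu>h"
    and \<mu>: "0 \<le> \<mu>F" "0 \<le> \<mu>h"
    and \<gamma>L: "8 * \<gamma>\<^sup>2 * Lip2 \<le> 1 - \<tau>" and \<gamma>\<mu>: "4 * \<gamma> * (\<mu>F + \<mu>h) \<le> 1 - \<tau>" and w: "w \<in> Z"
  shows "choice_mean M p \<tau> (\<lambda>(m, b). \<tau> * (norm (full m z w - zs))\<^sup>2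
        + (norm ((if b then full m z w else w) - zs))\<^sup>2)
    \<le> (1 - \<gamma> * ((\<mu>F + \<mu>h) / 16)) * (\<tau> * (norm (z - zs))\<^sup>2 + (norm (w - zs))\<^sup>2) + 2 * \<gamma>\<^sup>2 * Dev2"
proof -
  define y where "y = half z w"
  define \<kappa> where "\<kappa> = \<gamma> * (\<mu>F + \<mu>h)"
  define r a b where "r = (norm (y - zs))\<^sup>2" and "a = (norm (y - z))\<^sup>2" and "b = (norm (y - w))\<^sup>2"
  have nn: "0 \<le> r" "0 \<le> a" "0 \<le> b" by (auto simp: r_def a_def b_def)
  have \<kappa>: "0 \<le> \<kappa>" "4 * \<kappa> \<le> 1 - \<tau>" using \<mu> \<gamma> \<gamma>\<mu> by (auto simp: \<kappa>_def)
  have "choice_mean M p \<tau> (\<lambda>(m, b). \<tau> * (norm (full m z w - zs))\<^sup>2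
        + (norm ((if b then full m z w else w) - zs))\<^sup>2)
     = (\<Sum>m=1..M. p m * (norm (full m z w - zs))\<^sup>2 + p m * (\<tau> * (norm (w - zs))\<^sup>2))"
    unfolding choice_mean_def by (intro sum.cong) (auto simp: algebra_simps)
  also have "\<dots> = (\<Sum>m=1..M. p m * (norm (full m z w - zs))\<^sup>2) + \<tau> * (norm (w - zs))\<^sup>2"
    unfolding sum.distrib sum_distrib_right[symmetric] p_sum by simp
  also have "\<dots> \<le> \<tau> * (norm (z - zs))\<^sup>2 + (norm (w - zs))\<^sup>2 - \<tau> * a - (1 - \<tau>) * b
      + 2 * \<gamma>\<^sup>2 * (Lip2 * b + Dev2) - 2 * \<gamma> * (F y \<bullet> (y - zs) + hr y - hr zs)"
    using mean_extragradient_step[OF VI_solution_in_edom[OF sol] w, of z]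
    by (simp add: y_def a_def b_def algebra_simps)
  also have "\<dots> \<le> (1 - \<kappa> / 16) * (\<tau> * (norm (z - zs))\<^sup>2 + (norm (w - zs))\<^sup>2) + 2 * \<gamma>\<^sup>2 * Dev2"
  proof -
    have "(\<mu>F + \<mu>h) / 2 * r \<le> (\<mu>F + \<mu>h / 2) * r"
      using \<mu> nn by (intro mult_right_mono) auto
    also have "\<dots> \<le> F y \<bullet> (y - zs) + hr y - hr zs"
      using VI_solution_strong_monotonicity[OF sol sm half_in_edom] by (simp add: y_def r_def)
    finally have "2 * \<gamma> * ((\<mu>F + \<mu>h) / 2 * r) \<le> 2 * \<gamma> * (F y \<bullet> (y - zs) + hr y - hr zs)"
      using \<gamma> by (intro mult_left_mono) auto
    then have 1: "\<kappa> * r \<le> 2 * \<gamma> * (F y \<bullet> (y - zs) + hr y - hr zs)"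
      by (simp add: \<kappa>_def algebra_simps add_divide_distrib)
    have 2: "2 * \<gamma>\<^sup>2 * Lip2 * b \<le> (1 - \<tau>) / 4 * b"
      using \<gamma>L nn by (intro mult_right_mono) auto
    \<comment> \<open>The gain \<kappa> r is measured at y, whereas contraction is needed at z and
      w. Squared triangle inequalities give \<kappa> (\<tau> |z - zs|^2 + |w - zs|^2) \<le> 2 \<tau>
      a + 4 \<kappa> r + (1 - \<tau>) b / 2. A sixteenth of this fits into the available \<kappa> r
      + \<tau> a + 3/4 (1 - \<tau>) b.\<close>
    have "(\<kappa> * \<tau>) * (norm (z - zs))\<^sup>2 \<le> (\<kappa> * \<tau>) * (2 * a + 2 * r)"
      using \<kappa> \<tau> norm_diff_square_le[of z zs y] by (intro mult_left_mono) (auto simp: a_def r_def)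
    moreover have "\<kappa> * (norm (w - zs))\<^sup>2 \<le> \<kappa> * (2 * b + 2 * r)"
      using \<kappa> norm_diff_square_le[of w zs y] by (intro mult_left_mono) (auto simp: b_def r_def)
    moreover have "\<kappa> * (\<tau> * a) \<le> 1 * (\<tau> * a)"
      using \<kappa> \<tau> nn by (intro mult_right_mono) auto
    moreover have "\<tau> * (\<kappa> * r) \<le> 1 * (\<kappa> * r)"
      using \<kappa> \<tau> nn by (intro mult_right_mono) auto
    moreover have "\<kappa> * b \<le> (1 - \<tau>) / 4 * b"
      using \<kappa> nn by (intro mult_right_mono) auto
    moreover have "0 \<le> \<kappa> * r" "0 \<le> \<tau> * a" "0 \<le> (1 - \<tau>) * b" using \<kappa> \<tau> nn by auto
    ultimately show ?thesis using 1 2 by (simp add: algebra_simps)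
  qed
  finally show ?thesis by (simp add: \<kappa>_def)
qed

end

section \<open>The potential for the monotone case\<close>

text \<open>Each summand sees the choices made before and the choice being made, like an increment
  of an adapted process.\<close>

definition accumulate :: "('b list \<Rightarrow> 'b \<Rightarrow> 'c::comm_monoid_add) \<Rightarrow> 'b list \<Rightarrow> 'c" where
  "accumulate f l = (\<Sum>j<length l. f (take j l) (l ! j))"

lemma accumulate_Nil: "accumulate f [] = 0"
  by (simp add: accumulate_def)

lemma accumulate_snoc: "accumulate f (l @ [x]) = accumulate f l + f l x"
  by (simp add: accumulate_def nth_append)

text \<open>The vector that is - t v with probability 1 - t and (1 - t) v with probability t has
  mean zero and variance t (1 - t) |v|^2, so the cross terms with s cancel.\<close>

lemma coin_mean_square:
  fixes s v :: "'a::real_inner"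
  shows "(1 - t) * (norm (s - t *\<^sub>R v))\<^sup>2 + t * (norm (s + (1 - t) *\<^sub>R v))\<^sup>2
    = (norm s)\<^sup>2 + t * (1 - t) * (norm v)\<^sup>2"
  using dot_norm_neg[of s "t *\<^sub>R v"] dot_norm[of s "(1 - t) *\<^sub>R v"]
  by (simp add: power_mult_distrib) algebra

section \<open>Noise and drift of one step\<close>

context extragradient_problem
begin

definition step :: "'a \<times> 'a \<Rightarrow> nat \<times> bool \<Rightarrow> 'a \<times> 'a" where
  "step s x = (full (fst x) (fst s) (snd s), if snd x then full (fst x) (fst s) (snd s) else snd s)"

definition index_noise :: "nat \<Rightarrow> 'a \<Rightarrow> 'a \<Rightarrow> 'a" where
  "index_noise m z w = correction m z w + F w - F (half z w)"

text \<open>The sampling error scaled by \<gamma>, minus the deviation of the new w from its coin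
  average. Both parts have mean zero given the history.\<close>

definition noise :: "'a \<times> 'a \<Rightarrow> nat \<times> bool \<Rightarrow> 'a" where
  "noise s x = \<gamma> *\<^sub>R index_noise (fst x) (fst s) (snd s)
     - (snd (step s x) - (1 - \<tau>) *\<^sub>R fst (step s x) - \<tau> *\<^sub>R snd s)"

(* Expanding squared distances to u around c leaves an error affine in u - c: its linear part is
   noise, its constant part is collected in drift. *)
definition drift :: "'a \<Rightarrow> 'a \<times> 'a \<Rightarrow> nat \<times> bool \<Rightarrow> real" where
  "drift c s x = 2 * \<gamma>\<^sup>2 * (norm (correction (fst x) (fst s) (snd s)))\<^sup>2
     - 1 / 2 * (norm (half (fst s) (snd s) - fst (step s x)))\<^sup>2
     - (1 - \<tau>) * (norm (half (fst s) (snd s) - snd s))\<^sup>2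
     + (norm (snd (step s x) - c))\<^sup>2 - (1 - \<tau>) * (norm (fst (step s x) - c))\<^sup>2 - \<tau> * (norm (snd s - c))\<^sup>2
     - 2 * \<gamma> * (index_noise (fst x) (fst s) (snd s) \<bullet> (half (fst s) (snd s) - c))"

definition Lyapunov :: "'a \<Rightarrow> 'a \<times> 'a \<Rightarrow> real" where
  "Lyapunov u s = \<tau> * (norm (fst s - u))\<^sup>2 + (norm (snd s - u))\<^sup>2"

lemma snd_step_in_Z: "snd s \<in> Z \<Longrightarrow> snd (step s x) \<in> Z"
  by (simp add: step_def full_in_Z)

text \<open>Monotonicity moves the operator from y to u, the point at which the gap evaluates it;
  everything random is then sorted by its dependence on u.\<close>

lemma Lyapunov_step:
  fixes s x c
  defines "y \<equiv> half (fst s) (snd s)"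
  assumes mono: "strong_monotonicity Z F h 0 0" and u: "u \<in> edom h"
  shows "2 * \<gamma> * (F u \<bullet> (y - u) + hr y - hr u) + Lyapunov u (step s x)
    \<le> Lyapunov u s + drift c s x + 2 * (noise s x \<bullet> (u - c))"
proof -
  obtain z w m b where [simp]: "s = (z, w)" "x = (m, b)" by (cases s, cases x)
  define z' w' d f where "z' = fst (step s x)" and "w' = snd (step s x)"
    and "d = correction m z w" and "f = index_noise m z w"
  have z': "z' = full m z w" and y: "y = half z w" by (simp_all add: z'_def step_def y_def)
  have f: "d + F w = f + F y" by (simp add: f_def index_noise_def d_def y)
  have "0 \<le> (F y - F u) \<bullet> (y - u)"
    using mono u dom half_in_Z[of z w] y unfolding strong_monotonicity_def by force
  then have 1: "\<gamma> * (F u \<bullet> (y - u)) \<le> \<gamma> * (F y \<bullet> (y - u))"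
    using \<gamma> by (simp add: inner_diff_left)
  have 2: "f \<bullet> (y - u) = f \<bullet> (y - c) - f \<bullet> (u - c)"
    by (simp add: inner_diff_right)
  have sq: "(norm (v - u))\<^sup>2 = (norm (v - c))\<^sup>2 + (norm (u - c))\<^sup>2 - 2 * ((v - c) \<bullet> (u - c))" for v
    using dot_norm_neg[of "v - c" "u - c"] by simp
  have e: "(w' - (1 - \<tau>) *\<^sub>R z' - \<tau> *\<^sub>R w) \<bullet> (u - c)
    = (w' - c) \<bullet> (u - c) - (1 - \<tau>) * ((z' - c) \<bullet> (u - c)) - \<tau> * ((w - c) \<bullet> (u - c))"
    by (simp add: inner_diff_left inner_diff_right algebra_simps)
  \<comment> \<open>The terms |u - c|^2 carry the coefficient 1 - (1 - \<tau>) - \<tau> = 0.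
    Replacing |w' - u|^2 by its coin average thus costs a term linear in u - c and one free of
    u.\<close>
  have 3: "(norm (w' - u))\<^sup>2 = (1 - \<tau>) * (norm (z' - u))\<^sup>2 + \<tau> * (norm (w - u))\<^sup>2
      + ((norm (w' - c))\<^sup>2 - (1 - \<tau>) * (norm (z' - c))\<^sup>2 - \<tau> * (norm (w - c))\<^sup>2)
      - 2 * ((w' - (1 - \<tau>) *\<^sub>R z' - \<tau> *\<^sub>R w) \<bullet> (u - c))"
    unfolding e sq by (simp add: algebra_simps)
  have noise: "noise s x \<bullet> (u - c) = \<gamma> * (f \<bullet> (u - c)) - (w' - (1 - \<tau>) *\<^sub>R z' - \<tau> *\<^sub>R w) \<bullet> (u - c)"
    unfolding noise_def z'_def[symmetric] w'_def[symmetric] by (simp add: f_def inner_diff_left)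
  have drift: "drift c s x = 2 * \<gamma>\<^sup>2 * (norm d)\<^sup>2 - 1 / 2 * (norm (y - z'))\<^sup>2 - (1 - \<tau>) * (norm (y - w))\<^sup>2
     + (norm (w' - c))\<^sup>2 - (1 - \<tau>) * (norm (z' - c))\<^sup>2 - \<tau> * (norm (w - c))\<^sup>2
     - 2 * \<gamma> * (f \<bullet> (y - c))"
    unfolding drift_def z'_def[symmetric] w'_def[symmetric] by (simp add: f_def d_def y)
  have lyap: "Lyapunov u (step s x) = \<tau> * (norm (z' - u))\<^sup>2 + (norm (w' - u))\<^sup>2"
    by (simp add: Lyapunov_def z'_def w'_def)
  have 4: "2 * \<gamma> * ((f + F y) \<bullet> (y - u) + hr y - hr u)
    \<le> \<tau> * (norm (z - u))\<^sup>2 + (1 - \<tau>) * (norm (w - u))\<^sup>2 - (norm (z' - u))\<^sup>2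
      - 1 / 2 * (norm (y - z'))\<^sup>2 - (1 - \<tau>) * (norm (y - w))\<^sup>2 + 2 * \<gamma>\<^sup>2 * (norm d)\<^sup>2"
  proof -
    define t where "t = \<tau> * (norm (y - z))\<^sup>2"
    have "0 \<le> t" using \<tau> by (simp add: t_def)
    then show ?thesis
      using extragradient_step[OF u, of m z w, folded d_def y z'] unfolding f t_def[symmetric] by linarith
  qed
  have 5: "2 * \<gamma> * ((f + F y) \<bullet> (y - u) + hr y - hr u)
    = 2 * (\<gamma> * (f \<bullet> (y - c))) - 2 * (\<gamma> * (f \<bullet> (u - c))) + 2 * (\<gamma> * (F y \<bullet> (y - u))) + 2 * (\<gamma> * (hr y - hr u))"
    unfolding inner_add_left 2 by (simp add: algebra_simps)
  have 6: "2 * \<gamma> * (F u \<bullet> (y - u) + hr y - hr u) = 2 * (\<gamma> * (F u \<bullet> (y - u))) + 2 * (\<gamma> * (hr y - hr u))"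
    by (simp add: algebra_simps)
  show ?thesis
    using 1 4 unfolding 5 6 noise drift lyap 3 by (simp add: Lyapunov_def left_diff_distrib)
qed

lemma mean_index_noise: "(\<Sum>m=1..M. p m *\<^sub>R index_noise m z w) = 0"
proof -
  have "(\<Sum>m=1..M. p m *\<^sub>R index_noise m z w)
    = (\<Sum>m=1..M. p m *\<^sub>R correction m z w) + (\<Sum>m=1..M. p m) *\<^sub>R (F w - F (half z w))"
    by (simp add: index_noise_def scaleR_sum_left algebra_simps flip: sum.distrib sum_subtractf)
  then show ?thesis unfolding mean_correction p_sum by simp
qed

lemma mean_square_index_noise:
  "(\<Sum>m=1..M. p m * (norm (index_noise m z w))\<^sup>2) \<le> (\<Sum>m=1..M. p m * (norm (correction m z w))\<^sup>2)"
proof -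
  define g where "g = F (half z w) - F w"
  have sq: "(norm (index_noise m z w))\<^sup>2 = (norm (correction m z w))\<^sup>2 + (norm g)\<^sup>2 - 2 * (correction m z w \<bullet> g)" for m
    using dot_norm_neg[of "correction m z w" g] by (simp add: index_noise_def g_def algebra_simps)
  have "(\<Sum>m=1..M. p m * (norm (index_noise m z w))\<^sup>2)
    = (\<Sum>m=1..M. p m * (norm (correction m z w))\<^sup>2) + (\<Sum>m=1..M. p m) * (norm g)\<^sup>2
      - 2 * ((\<Sum>m=1..M. p m *\<^sub>R correction m z w) \<bullet> g)"
    unfolding sq inner_sum_left sum_distrib_left sum_distrib_right sum.distrib[symmetric] sum_subtractf[symmetric]
    by (intro sum.cong refl) (simp add: algebra_simps)
  also have "\<dots> = (\<Sum>m=1..M. p m * (norm (correction m z w))\<^sup>2) - (norm g)\<^sup>2"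
    unfolding mean_correction p_sum g_def[symmetric] by (simp add: power2_norm_eq_inner)
  finally show ?thesis by simp
qed

text \<open>The negative terms of \<open>drift\<close> pay for the variance that
  \<open>noise\<close> adds to |S|^2 / 4. The coin is averaged with the index held fixed, because
  the jump z' - w depends on the index.\<close>

lemma choice_mean_drift:
  assumes w: "snd s \<in> Z" and \<gamma>L: "16 * \<gamma>\<^sup>2 * Lip2 \<le> 1 - \<tau>"
  shows "choice_mean M p \<tau> (\<lambda>x. drift c s x + 1 / 4 * (norm (S + noise s x))\<^sup>2)
    \<le> 1 / 4 * (norm S)\<^sup>2 + 9 / 4 * \<gamma>\<^sup>2 * Dev2"
proof -
  obtain z w where [simp]: "s = (z, w)" by (cases s)
  define y where "y = half z w"
  define d f where "d m = correction m z w" and "f m = index_noise m z w" for m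
  define e where "e = (norm (y - w))\<^sup>2"
  have coin: "(1 - \<tau>) * (drift c s (m, True) + 1 / 4 * (norm (S + noise s (m, True)))\<^sup>2)
      + \<tau> * (drift c s (m, False) + 1 / 4 * (norm (S + noise s (m, False)))\<^sup>2)
    \<le> 1 / 4 * (norm S)\<^sup>2 - (1 - \<tau>) / 2 * e + 2 * \<gamma>\<^sup>2 * (norm (d m))\<^sup>2
      + 1 / 4 * \<gamma>\<^sup>2 * (norm (f m))\<^sup>2 + f m \<bullet> ((\<gamma> / 2) *\<^sub>R S - (2 * \<gamma>) *\<^sub>R (y - c))" for m
  proof -
    define z' where "z' = full m z w"
    define q where "q = (norm (y - z'))\<^sup>2"
    define r where "r = (norm (S + \<gamma> *\<^sub>R f m))\<^sup>2"
    define t where "t = (norm (z' - w))\<^sup>2"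
    have nn: "0 \<le> q" "0 \<le> e" by (auto simp: q_def e_def)
    have nT: "S + noise s (m, True) = (S + \<gamma> *\<^sub>R f m) - \<tau> *\<^sub>R (z' - w)"
      and nF: "S + noise s (m, False) = (S + \<gamma> *\<^sub>R f m) + (1 - \<tau>) *\<^sub>R (z' - w)"
      by (simp_all add: noise_def step_def f_def z'_def algebra_simps)
    have dT: "drift c s (m, True) = 2 * \<gamma>\<^sup>2 * (norm (d m))\<^sup>2 - 1 / 2 * q - (1 - \<tau>) * e
        + \<tau> * ((norm (z' - c))\<^sup>2 - (norm (w - c))\<^sup>2) - 2 * \<gamma> * (f m \<bullet> (y - c))"
      and dF: "drift c s (m, False) = 2 * \<gamma>\<^sup>2 * (norm (d m))\<^sup>2 - 1 / 2 * q - (1 - \<tau>) * e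
        - (1 - \<tau>) * ((norm (z' - c))\<^sup>2 - (norm (w - c))\<^sup>2) - 2 * \<gamma> * (f m \<bullet> (y - c))"
      by (simp_all add: drift_def step_def f_def z'_def y_def d_def q_def e_def algebra_simps)
    have "(1 - \<tau>) * (drift c s (m, True) + 1 / 4 * (norm (S + noise s (m, True)))\<^sup>2)
      + \<tau> * (drift c s (m, False) + 1 / 4 * (norm (S + noise s (m, False)))\<^sup>2)
      = (1 - \<tau>) * drift c s (m, True) + \<tau> * drift c s (m, False)
        + 1 / 4 * ((1 - \<tau>) * (norm (S + noise s (m, True)))\<^sup>2 + \<tau> * (norm (S + noise s (m, False)))\<^sup>2)"
      by (simp add: field_simps)
    \<comment> \<open>The difference |z' - c|^2 - |w - c|^2 enters with factors \<tau> and - (1 -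
      \<tau>), which the coin probabilities cancel.\<close>
    also have "(1 - \<tau>) * drift c s (m, True) + \<tau> * drift c s (m, False)
      = 2 * \<gamma>\<^sup>2 * (norm (d m))\<^sup>2 - 1 / 2 * q - (1 - \<tau>) * e - 2 * \<gamma> * (f m \<bullet> (y - c))"
      unfolding dT dF by algebra
    also have "(1 - \<tau>) * (norm (S + noise s (m, True)))\<^sup>2 + \<tau> * (norm (S + noise s (m, False)))\<^sup>2
      = r + \<tau> * (1 - \<tau>) * t"
      unfolding nT nF r_def t_def by (rule coin_mean_square)
    also have "r = (norm S)\<^sup>2 + 2 * \<gamma> * (f m \<bullet> S) + \<gamma>\<^sup>2 * (norm (f m))\<^sup>2"
      using dot_norm[of S "\<gamma> *\<^sub>R f m"] by (simp add: r_def power_mult_distrib inner_commute)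
    finally have eq: "(1 - \<tau>) * (drift c s (m, True) + 1 / 4 * (norm (S + noise s (m, True)))\<^sup>2)
      + \<tau> * (drift c s (m, False) + 1 / 4 * (norm (S + noise s (m, False)))\<^sup>2)
      = 2 * \<gamma>\<^sup>2 * (norm (d m))\<^sup>2 - 1 / 2 * q - (1 - \<tau>) * e - 2 * \<gamma> * (f m \<bullet> (y - c))
        + 1 / 4 * ((norm S)\<^sup>2 + 2 * \<gamma> * (f m \<bullet> S) + \<gamma>\<^sup>2 * (norm (f m))\<^sup>2 + \<tau> * (1 - \<tau>) * t)" .
    \<comment> \<open>Going from w to z' through y, a quarter of the coin variance is at most q / 2
      + (1 - \<tau>) e / 2. This uses up the term - q / 2 and half of - (1 - \<tau>) e.\<close>
    have "\<tau> * (1 - \<tau>) * t \<le> \<tau> * (1 - \<tau>) * (2 * q + 2 * e)"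
      using \<tau> norm_diff_square_le[of z' w y] by (intro mult_left_mono) (auto simp: q_def t_def e_def)
    moreover have le: "\<tau> * (1 - \<tau>) \<le> 1 - \<tau>" using \<tau> mult_right_mono[of \<tau> 1 "1 - \<tau>"] by simp
    moreover have "\<tau> * (1 - \<tau>) * q \<le> 1 * q" using le \<tau> nn by (intro mult_right_mono) linarith+
    moreover have "\<tau> * (1 - \<tau>) * e \<le> (1 - \<tau>) * e" using le nn by (intro mult_right_mono)
    ultimately have "\<tau> * (1 - \<tau>) * t \<le> 2 * q + 2 * ((1 - \<tau>) * e)"
      by (simp add: algebra_simps)
    then show ?thesis
      unfolding eq inner_diff_right inner_scaleR_right by (simp add: field_simps)
  qed
  have "choice_mean M p \<tau> (\<lambda>x. drift c s x + 1 / 4 * (norm (S + noise s x))\<^sup>2)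
    \<le> (\<Sum>m=1..M. p m * (1 / 4 * (norm S)\<^sup>2 - (1 - \<tau>) / 2 * e + 2 * \<gamma>\<^sup>2 * (norm (d m))\<^sup>2
      + 1 / 4 * \<gamma>\<^sup>2 * (norm (f m))\<^sup>2 + f m \<bullet> ((\<gamma> / 2) *\<^sub>R S - (2 * \<gamma>) *\<^sub>R (y - c))))"
    unfolding choice_mean_def using coin p_pos by (intro sum_mono mult_left_mono) (auto intro: less_imp_le)
  also have "\<dots> = (\<Sum>m=1..M. p m) * (1 / 4 * (norm S)\<^sup>2 - (1 - \<tau>) / 2 * e)
      + 2 * \<gamma>\<^sup>2 * (\<Sum>m=1..M. p m * (norm (d m))\<^sup>2) + 1 / 4 * \<gamma>\<^sup>2 * (\<Sum>m=1..M. p m * (norm (f m))\<^sup>2)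
      + (\<Sum>m=1..M. p m *\<^sub>R f m) \<bullet> ((\<gamma> / 2) *\<^sub>R S - (2 * \<gamma>) *\<^sub>R (y - c))"
    unfolding inner_sum_left sum_distrib_left sum_distrib_right sum.distrib[symmetric]
    by (intro sum.cong refl) (simp add: algebra_simps)
  also have "\<dots> = 1 / 4 * (norm S)\<^sup>2 - (1 - \<tau>) / 2 * e
      + 2 * \<gamma>\<^sup>2 * (\<Sum>m=1..M. p m * (norm (d m))\<^sup>2) + 1 / 4 * \<gamma>\<^sup>2 * (\<Sum>m=1..M. p m * (norm (f m))\<^sup>2)"
    unfolding f_def mean_index_noise p_sum by simp
  also have "\<dots> \<le> 1 / 4 * (norm S)\<^sup>2 - (1 - \<tau>) / 2 * e
      + 2 * \<gamma>\<^sup>2 * (Lip2 * e + Dev2) + 1 / 4 * \<gamma>\<^sup>2 * (Lip2 * e + Dev2)"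
  proof -
    have "(\<Sum>m=1..M. p m * (norm (d m))\<^sup>2) \<le> Lip2 * e + Dev2"
      using mean_square_correction[of w z] w by (simp add: d_def e_def y_def)
    moreover have "(\<Sum>m=1..M. p m * (norm (f m))\<^sup>2) \<le> (\<Sum>m=1..M. p m * (norm (d m))\<^sup>2)"
      unfolding d_def f_def by (rule mean_square_index_noise)
    ultimately show ?thesis
      by (intro add_mono order_refl mult_left_mono) auto
  qed
  \<comment> \<open>The factor 9/4 is 2 from Young's inequality in the step plus 1/4 from the index
    noise in |S|^2 / 4. Its \<open>Lip2\<close> part is at most 9/64 (1 - \<tau>) e, below the
    remaining (1 - \<tau>) e / 2.\<close>
  also have "\<dots> \<le> 1 / 4 * (norm S)\<^sup>2 + 9 / 4 * \<gamma>\<^sup>2 * Dev2"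
  proof -
    have "16 * \<gamma>\<^sup>2 * Lip2 * e \<le> (1 - \<tau>) * e" using \<gamma>L by (intro mult_right_mono) (auto simp: e_def)
    moreover have "0 \<le> (1 - \<tau>) * e" using \<tau> by (auto simp: e_def)
    ultimately show ?thesis by (simp add: algebra_simps)
  qed
  finally show ?thesis .
qed

text \<open>The algorithm replayed on an arbitrary list of choices; prefixes of one list yield the
  trajectory. Estimates hold for all lists since \<open>half\<close> and \<open>full\<close> always
  land in the domain of h.\<close>

definition state :: "'a \<Rightarrow> (nat \<times> bool) list \<Rightarrow> 'a \<times> 'a" where
  "state c l = foldl step (c, c) l"

definition half_state :: "'a \<Rightarrow> (nat \<times> bool) list \<Rightarrow> 'a" where
  "half_state c l = half (fst (state c l)) (snd (state c l))"

lemma state_Nil: "state c [] = (c, c)" and state_snoc: "state c (l @ [x]) = step (state c l) x"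
  by (simp_all add: state_def)

lemma snd_state_in_Z: "c \<in> Z \<Longrightarrow> snd (state c l) \<in> Z"
  by (induction l rule: rev_induct) (auto simp: state_Nil state_snoc snd_step_in_Z)

(* With c = z0: the part of the accumulated Lyapunov_step that does not depend on u, after splitting
   2 * (S \<bullet> (u - c)) for the accumulated noise S. *)
definition potential :: "'a \<Rightarrow> (nat \<times> bool) list \<Rightarrow> real" where
  "potential c l = accumulate (\<lambda>l. drift c (state c l)) l
     + 1 / 4 * (norm (accumulate (\<lambda>l. noise (state c l)) l))\<^sup>2"

lemma potential_Nil: "potential c [] = 0"
  by (simp add: potential_def accumulate_Nil)

lemma choice_mean_add: "choice_mean M p \<tau> (\<lambda>x. a + f x) = a + choice_mean M p \<tau> f"
proof -
  have "choice_mean M p \<tau> (\<lambda>x. a + f x) = (\<Sum>m=1..M. p m * a + p m * ((1 - \<tau>) * f (m, True) + \<tau> * f (m, False)))"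
    unfolding choice_mean_def by (intro sum.cong) (auto simp: algebra_simps)
  also have "\<dots> = (\<Sum>m=1..M. p m) * a + choice_mean M p \<tau> f"
    unfolding sum.distrib sum_distrib_right choice_mean_def ..
  finally show ?thesis unfolding p_sum by simp
qed

lemma choice_mean_potential:
  assumes "c \<in> Z" "16 * \<gamma>\<^sup>2 * Lip2 \<le> 1 - \<tau>"
  shows "choice_mean M p \<tau> (\<lambda>x. potential c (l @ [x])) \<le> potential c l + 9 / 4 * \<gamma>\<^sup>2 * Dev2"
  using choice_mean_drift[OF snd_state_in_Z[OF assms(1)] assms(2), of c l "accumulate (\<lambda>l. noise (state c l)) l"]
  unfolding potential_def accumulate_snoc add.assoc choice_mean_add by simp

text \<open>Telescoping \<open>Lyapunov_step\<close> works for each list and all u at once. The 6 is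
  1 + \<tau> \<le> 2 from the start in (c, c) plus 4 from splitting the noise term.\<close>

lemma accumulated_regret:
  assumes mono: "strong_monotonicity Z F h 0 0" and u: "u \<in> edom h"
  shows "2 * \<gamma> * accumulate (\<lambda>l x. F u \<bullet> (half_state c l - u) + hr (half_state c l) - hr u) l
    \<le> 6 * (norm (c - u))\<^sup>2 + potential c l"
proof -
  define S where "S = accumulate (\<lambda>l. noise (state c l)) l"
  have "2 * \<gamma> * accumulate (\<lambda>l x. F u \<bullet> (half_state c l - u) + hr (half_state c l) - hr u) l + Lyapunov u (state c l)
    \<le> Lyapunov u (c, c) + accumulate (\<lambda>l. drift c (state c l)) l
      + 2 * (accumulate (\<lambda>l. noise (state c l)) l \<bullet> (u - c))"
  proof (induction l rule: rev_induct)
    case Nil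
    then show ?case by (simp add: accumulate_Nil state_Nil)
  next
    case (snoc x l)
    then show ?case
      using Lyapunov_step[OF mono u, of "state c l" x c]
      unfolding accumulate_snoc state_snoc half_state_def[symmetric] inner_add_left distrib_left
      by linarith
  qed
  moreover have "Lyapunov u (c, c) \<le> 2 * (norm (c - u))\<^sup>2"
    using \<tau> mult_right_mono[of \<tau> 1 "(norm (c - u))\<^sup>2"] by (simp add: Lyapunov_def)
  moreover have "0 \<le> Lyapunov u (state c l)"
    using \<tau> by (simp add: Lyapunov_def)
  moreover have "2 * (S \<bullet> (u - c)) \<le> 1 / 4 * (norm S)\<^sup>2 + 4 * (norm (c - u))\<^sup>2"
  proof -
    define t where "t = (norm ((1 / 2) *\<^sub>R S - 2 *\<^sub>R (u - c)))\<^sup>2"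
    then have "0 \<le> t" by simp
    then show ?thesis
      using dot_norm_neg[of "(1 / 2) *\<^sub>R S" "2 *\<^sub>R (u - c)"] unfolding t_def[symmetric]
      by (simp add: power_mult_distrib power2_eq_square[of "1 / 2 :: real"] power_divide norm_minus_commute[of u c])
  qed
  ultimately show ?thesis unfolding potential_def S_def by linarith
qed

end

section \<open>Convergence\<close>

context extragradient_problem
begin

text \<open>The expression under the supremum is affine in the point except for h, so Jensen's
  inequality passes to the average of the half steps. The lower bound comes from the competitor
  \<open>zs\<close>.\<close>

lemma
  fixes c :: 'a and l :: "(nat \<times> bool) list"
  defines "zhat \<equiv> (1 / real (length l)) *\<^sub>R (\<Sum>k<length l. half_state c (take k l))"
  assumes mono: "strong_monotonicity Z F h 0 0" and sol: "VI_solution Z F h zs"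
    and l: "length l \<ge> 1"
  shows averaged_gap_nonneg: "zs \<in> C \<Longrightarrow> 0 \<le> Gap C F h zhat"
    and averaged_gap_le: "bdd_above ((\<lambda>u. (norm (c - u))\<^sup>2) ` C) \<Longrightarrow>
      Gap C F h zhat \<le> ereal ((6 * (SUP u\<in>C. (norm (c - u))\<^sup>2) + potential c l) / (2 * \<gamma> * real (length l)))"
proof -
  define K y where "K = length l" and "y k = half_state c (take k l)" for k
  have K: "0 < real K" using l by (cases l) (auto simp: K_def)
  note cv = convex_on_edom[OF h(1,3)]
  have y: "y k \<in> edom h" for k by (simp add: y_def half_state_def half_in_edom)
  have zhat: "zhat = (\<Sum>k<K. (1 / real K) *\<^sub>R y k)"
    by (simp add: zhat_def K_def y_def scaleR_sum_right)
  have zhat_in: "zhat \<in> edom h"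
    unfolding zhat using convex_on_imp_convex[OF cv] K y by (intro convex_sum) auto
  have jensen: "hr zhat \<le> (\<Sum>k<K. (1 / real K) * hr (y k))"
    unfolding zhat using K y by (intro convex_on_sum[OF _ _ cv]) auto
  obtain a where a: "h zhat = ereal a" using proper_fun_edomE[OF h(1) zhat_in] by blast
  show "0 \<le> Gap C F h zhat" if "zs \<in> C"
  proof -
    have "0 \<le> ereal (F zs \<bullet> (zhat - zs)) + h zhat - h zs"
      using sol zhat_in dom by (auto simp: VI_solution_def)
    then show ?thesis unfolding Gap_def by (rule SUP_upper2[OF that])
  qed
  let ?R = "SUP u\<in>C. (norm (c - u))\<^sup>2"
  show "Gap C F h zhat \<le> ereal ((6 * ?R + potential c l) / (2 * \<gamma> * real (length l)))"
    if bdd: "bdd_above ((\<lambda>u. (norm (c - u))\<^sup>2) ` C)"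
    unfolding Gap_def
  proof (rule SUP_least)
    fix u assume u: "u \<in> C"
    show "ereal (F u \<bullet> (zhat - u)) + h zhat - h u \<le> ereal ((6 * ?R + potential c l) / (2 * \<gamma> * real (length l)))"
    proof (cases "u \<in> edom h")
      \<comment> \<open>Such u contribute - \<infinity>, because h is finite at
        \<open>zhat\<close>.\<close>
      case False
      then show ?thesis by (simp add: a edom_def)
    next
      case True
      then obtain b where b: "h u = ereal b" using proper_fun_edomE[OF h(1)] by blast
      have "F u \<bullet> (zhat - u) + a - b \<le> (\<Sum>k<K. (1 / real K) * (F u \<bullet> (y k - u) + hr (y k) - b))"
      proof -
        have "F u \<bullet> (zhat - u) = (\<Sum>k<K. (1 / real K) * (F u \<bullet> (y k - u)))"
        proof -
          have "zhat - u = (\<Sum>k<K. (1 / real K) *\<^sub>R (y k - u))"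
            using K by (simp add: zhat scaleR_diff_right sum_subtractf sum_constant_scaleR)
          then show ?thesis by (simp add: inner_sum_right)
        qed
        moreover have "b = (\<Sum>k<K. (1 / real K) * b)" using K by simp
        ultimately show ?thesis
          using jensen a by (simp add: distrib_left right_diff_distrib sum.distrib sum_subtractf)
      qed
      also have "\<dots> = (2 * \<gamma> * (\<Sum>k<K. F u \<bullet> (y k - u) + hr (y k) - hr u)) / (2 * \<gamma> * real K)"
        using \<gamma> b by (simp add: sum_divide_distrib)
      also have "\<dots> \<le> (6 * (norm (c - u))\<^sup>2 + potential c l) / (2 * \<gamma> * real K)"
        using accumulated_regret[OF mono True, of c l] \<gamma> K
        by (intro divide_right_mono) (auto simp: accumulate_def K_def y_def)
      also have "\<dots> \<le> (6 * ?R + potential c l) / (2 * \<gamma> * real K)"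
        using cSUP_upper[OF u bdd] \<gamma> K by (intro divide_right_mono) auto
      finally show ?thesis by (simp add: a b K_def)
    qed
  qed
qed

end

lemma ereal_stepsize_bound:
  assumes "ereal \<gamma> \<le> ereal (sqrt a) / ereal b" "0 < \<gamma>" "0 < a" "0 \<le> b"
  shows "\<gamma>\<^sup>2 * b\<^sup>2 \<le> a"
proof (cases "b = 0")
  case False
  then have "\<gamma> * b \<le> sqrt a"
    using assms by (simp add: field_simps)
  then have "(\<gamma> * b)\<^sup>2 \<le> (sqrt a)\<^sup>2"
    using assms by (intro power_mono) auto
  then show ?thesis using assms by (simp add: power_mult_distrib)
qed (use assms in simp)

lemma take_history: "j \<le> k \<Longrightarrow> take j (history \<eta> \<xi> k \<omega>) = history \<eta> \<xi> j \<omega>"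
  by (simp add: history_def take_map)

lemma length_history: "length (history \<eta> \<xi> k \<omega>) = k"
  by (simp add: history_def)

section \<open>Expected distance and expected gap\<close>

context extragradient_problem
begin

lemma iterates_eq_state:
  assumes IS: "extragradient_IS P K p \<tau> \<gamma> h F Fm z0 \<eta> \<xi> z zh w" and \<omega>: "\<omega> \<in> space P"
  shows "k \<le> K \<Longrightarrow> state z0 (history \<eta> \<xi> k \<omega>) = (z k \<omega>, w k \<omega>)"
    and "k < K \<Longrightarrow> half_state z0 (history \<eta> \<xi> k \<omega>) = zh k \<omega>"
proof -
  note IS = IS[unfolded extragradient_IS_def Let_def, rule_format, OF \<omega>]
  have zh: "zh k \<omega> = half (z k \<omega>) (w k \<omega>)" if "k < K" for k
    using IS that by (simp add: half_def)
  show state: "k \<le> K \<Longrightarrow> state z0 (history \<eta> \<xi> k \<omega>) = (z k \<omega>, w k \<omega>)" for k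
  proof (induction k)
    case 0
    then show ?case using IS by (simp add: history_def state_Nil)
  next
    case (Suc k)
    then have k: "k < K" by simp
    have "z (Suc k) \<omega> = full (\<eta> k \<omega>) (z k \<omega>) (w k \<omega>)"
      using IS k by (simp add: full_def flip: zh[OF k])
    moreover have "w (Suc k) \<omega> = (if \<xi> k \<omega> then z (Suc k) \<omega> else w k \<omega>)"
      using IS k by blast
    ultimately show ?case
      using Suc.IH k by (simp add: history_Suc state_snoc step_def)
  qed
  show "k < K \<Longrightarrow> half_state z0 (history \<eta> \<xi> k \<omega>) = zh k \<omega>"
    by (simp add: half_state_def state zh)
qed

lemma strongly_monotone_convergence:
  assumes P: "prob_space P" and sol: "VI_solution Z F h zs" and z0: "z0 \<in> Z"
    and choices: "random_choices P K M p \<tau> \<eta> \<xi>"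
    and IS: "extragradient_IS P K p \<tau> \<gamma> h F Fm z0 \<eta> \<xi> z zh w"
    and sm: "strong_monotonicity Z F h \<mu>F \<mu>h" and \<mu>: "0 \<le> \<mu>F" "0 \<le> \<mu>h" "0 < \<mu>F + \<mu>h"
    and \<gamma>L: "8 * \<gamma>\<^sup>2 * Lip2 \<le> 1 - \<tau>" and \<gamma>\<mu>: "4 * \<gamma> * (\<mu>F + \<mu>h) \<le> 1 - \<tau>"
  shows "integrable P (\<lambda>\<omega>. \<tau> * (norm (z K \<omega> - zs))\<^sup>2 + (norm (w K \<omega> - zs))\<^sup>2)" (is ?int)
    and "(\<integral>\<omega>. \<tau> * (norm (z K \<omega> - zs))\<^sup>2 + (norm (w K \<omega> - zs))\<^sup>2 \<partial>P)
      \<le> (1 - \<gamma> * ((\<mu>F + \<mu>h) / 16)) ^ K * Lyapunov zs (z0, z0) + 32 * \<gamma> / (\<mu>F + \<mu>h) * Dev2" (is ?le)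
proof -
  define a where "a = 1 - \<gamma> * ((\<mu>F + \<mu>h) / 16)"
  define f where "f l = Lyapunov zs (state z0 l)" for l
  have a: "0 \<le> a" "a < 1" using \<gamma>\<mu> \<gamma> \<mu> \<tau> by (auto simp: a_def)
  have eq: "\<tau> * (norm (z K \<omega> - zs))\<^sup>2 + (norm (w K \<omega> - zs))\<^sup>2 = f (history \<eta> \<xi> K \<omega>)" if "\<omega> \<in> space P" for \<omega>
    using iterates_eq_state(1)[OF IS that order_refl] by (simp add: f_def Lyapunov_def)
  have "integrable P (\<lambda>\<omega>. f (history \<eta> \<xi> K \<omega>))"
    by (rule integrable_history[OF P choices p_sum order_refl])
  then show ?int by (subst Bochner_Integration.integrable_cong[OF refl eq])
  have step: "choice_mean M p \<tau> (\<lambda>x. f (l @ [x])) \<le> a * f l + 2 * \<gamma>\<^sup>2 * Dev2" for l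
  proof -
    have "(\<lambda>x. f (l @ [x])) = (\<lambda>(m, b). \<tau> * (norm (full m (fst (state z0 l)) (snd (state z0 l)) - zs))\<^sup>2
        + (norm ((if b then full m (fst (state z0 l)) (snd (state z0 l)) else snd (state z0 l)) - zs))\<^sup>2)"
      by (auto simp: f_def state_snoc step_def Lyapunov_def)
    then show ?thesis
      using choice_mean_Lyapunov[OF sol sm \<mu>(1,2) \<gamma>L \<gamma>\<mu> snd_state_in_Z[OF z0, of l], of "fst (state z0 l)"]
      by (simp add: a_def f_def Lyapunov_def)
  qed
  have "(\<integral>\<omega>. \<tau> * (norm (z K \<omega> - zs))\<^sup>2 + (norm (w K \<omega> - zs))\<^sup>2 \<partial>P) = (\<integral>\<omega>. f (history \<eta> \<xi> K \<omega>) \<partial>P)"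
    by (rule Bochner_Integration.integral_cong[OF refl eq])
  also have "\<dots> \<le> a ^ K * f [] + 2 * \<gamma>\<^sup>2 * Dev2 * (\<Sum>j<K. a ^ j)"
    by (rule integral_history_contraction[OF P choices p_sum step a(1) order_refl])
  \<comment> \<open>The geometric series is at most 1 / (1 - a) = 16 / (\<gamma> (\<mu>F + \<mu>h));
    with the error 2 \<gamma>^2 \<open>Dev2\<close> per step this produces the factor 32
    \<gamma>.\<close>
  also have "2 * \<gamma>\<^sup>2 * Dev2 * (\<Sum>j<K. a ^ j) \<le> 2 * \<gamma>\<^sup>2 * Dev2 * (1 / (1 - a))"
  proof (intro mult_left_mono)
    have "(\<Sum>j<K. a ^ j) = (1 - a ^ K) / (1 - a)"
      using a sum_gp_strict[of a K] by simp
    then show "(\<Sum>j<K. a ^ j) \<le> 1 / (1 - a)"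
      using a by (simp add: divide_right_mono)
  qed (use Dev2_nonneg in simp)
  also have "2 * \<gamma>\<^sup>2 * Dev2 * (1 / (1 - a)) = 32 * \<gamma> / (\<mu>F + \<mu>h) * Dev2"
    using \<gamma> \<mu>(3) by (simp add: a_def power2_eq_square)
  finally show ?le by (simp add: a_def f_def state_Nil)
qed

lemma monotone_gap_convergence:
  assumes P: "prob_space P" and sol: "VI_solution Z F h zs" and z0: "z0 \<in> Z"
    and choices: "random_choices P K M p \<tau> \<eta> \<xi>"
    and IS: "extragradient_IS P K p \<tau> \<gamma> h F Fm z0 \<eta> \<xi> z zh w" and K: "K \<ge> 1"
    and C: "compact C" "zs \<in> C"
    and mono: "strong_monotonicity Z F h 0 0"
    and \<gamma>L: "16 * \<gamma>\<^sup>2 * Lip2 \<le> 1 - \<tau>"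
  defines "gap \<equiv> \<lambda>\<omega>. Gap C F h ((1 / real K) *\<^sub>R (\<Sum>k<K. zh k \<omega>))"
  shows "\<omega> \<in> space P \<Longrightarrow> \<bar>gap \<omega>\<bar> \<noteq> \<infinity>"
    and "integrable P (\<lambda>\<omega>. real_of_ereal (gap \<omega>))" (is ?int)
    and "(\<integral>\<omega>. real_of_ereal (gap \<omega>) \<partial>P)
      \<le> 3 * (SUP u\<in>C. (norm (z0 - u))\<^sup>2) / (\<gamma> * real K) + 9 / 8 * \<gamma> * Dev2" (is ?le)
proof -
  interpret prob_space P by (rule P)
  let ?H = "history \<eta> \<xi> K" and ?R = "SUP u\<in>C. (norm (z0 - u))\<^sup>2"
  define g where "g l = Gap C F h ((1 / real K) *\<^sub>R (\<Sum>k<K. half_state z0 (take k l)))" for l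
  have bdd: "bdd_above ((\<lambda>u. (norm (z0 - u))\<^sup>2) ` C)"
    by (intro bounded_imp_bdd_above compact_imp_bounded compact_continuous_image C(1) continuous_intros)
  have eq: "gap \<omega> = g (?H \<omega>)" if "\<omega> \<in> space P" for \<omega>
    using iterates_eq_state(2)[OF IS that] by (simp add: gap_def g_def take_history)
  have bounds: "0 \<le> g (?H \<omega>)"
    "g (?H \<omega>) \<le> ereal ((6 * ?R + potential z0 (?H \<omega>)) / (2 * \<gamma> * real K))" for \<omega>
    using averaged_gap_nonneg[OF mono sol _ C(2), of "?H \<omega>" z0]
      averaged_gap_le[OF mono sol _ bdd, of "?H \<omega>"] K by (simp_all add: g_def length_history)
  \<comment> \<open>Bounds on both sides exclude infinite values, so that
    \<open>real_of_ereal\<close> loses nothing.\<close>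
  have real: "\<bar>g (?H \<omega>)\<bar> \<noteq> \<infinity>"
    "real_of_ereal (g (?H \<omega>)) \<le> (6 * ?R + potential z0 (?H \<omega>)) / (2 * \<gamma> * real K)" for \<omega>
    using bounds[of \<omega>] by (cases "g (?H \<omega>)"; simp)+
  show "\<omega> \<in> space P \<Longrightarrow> \<bar>gap \<omega>\<bar> \<noteq> \<infinity>"
    using real(1) by (simp add: eq)
  \<comment> \<open>Every real function of the discrete history is measurable, which settles the
    measurability of the supremum in the gap.\<close>
  have int: "integrable P (\<lambda>\<omega>. f (?H \<omega>))" for f :: "(nat \<times> bool) list \<Rightarrow> real"
    by (rule integrable_history[OF P choices p_sum order_refl])
  show ?int
    using int[of "\<lambda>l. real_of_ereal (g l)"]
    by (subst Bochner_Integration.integrable_cong[OF refl arg_cong[OF eq, of _ real_of_ereal]])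
  \<comment> \<open>Factor 1 in the Gronwall bound: the potential starts at 0 and gains at most 9/4
    \<gamma>^2 \<open>Dev2\<close> per step in mean.\<close>
  have E: "(\<integral>\<omega>. potential z0 (?H \<omega>) \<partial>P) \<le> 9 / 4 * \<gamma>\<^sup>2 * Dev2 * real K"
  proof -
    have "choice_mean M p \<tau> (\<lambda>x. potential z0 (l @ [x])) \<le> 1 * potential z0 l + 9 / 4 * \<gamma>\<^sup>2 * Dev2" for l
      using choice_mean_potential[OF z0 \<gamma>L] by simp
    from integral_history_contraction[OF P choices p_sum this _ order_refl] show ?thesis
      by (simp add: potential_Nil)
  qed
  have "(\<integral>\<omega>. real_of_ereal (gap \<omega>) \<partial>P) = (\<integral>\<omega>. real_of_ereal (g (?H \<omega>)) \<partial>P)"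
    by (rule Bochner_Integration.integral_cong) (simp_all add: eq)
  also have "\<dots> \<le> (\<integral>\<omega>. (6 * ?R + potential z0 (?H \<omega>)) / (2 * \<gamma> * real K) \<partial>P)"
    using int[of "\<lambda>l. real_of_ereal (g l)"] int[of "\<lambda>l. (6 * ?R + potential z0 l) / (2 * \<gamma> * real K)"] real(2)
    by (intro integral_mono)
  also have "\<dots> = (6 * ?R + (\<integral>\<omega>. potential z0 (?H \<omega>) \<partial>P)) / (2 * \<gamma> * real K)"
    using int[of "potential z0"] by (simp add: prob_space)
  also have "\<dots> \<le> (6 * ?R + 9 / 4 * \<gamma>\<^sup>2 * Dev2 * real K) / (2 * \<gamma> * real K)"
    using E \<gamma> by (intro divide_right_mono) auto
  also have "\<dots> = 3 * ?R / (\<gamma> * real K) + 9 / 8 * \<gamma> * Dev2"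
    using \<gamma> K by (simp add: field_simps power2_eq_square)
  finally show ?le .
qed

end

(* The upper bounds on \<gamma> are stated in ereal, where a / 0 = \<infinity> for a > 0, so that vanishing
   Lipschitz constants impose no restriction on \<gamma>. *)
theorem mainTheorem10:
  fixes P :: "'s measure"
    and h :: "'a::euclidean_space \<Rightarrow> ereal"
    and F :: "'a \<Rightarrow> 'a" and Fm :: "nat \<Rightarrow> 'a \<Rightarrow> 'a"
    and Z C :: "'a set" and zs z0 :: 'a
    and \<tau> \<gamma> L D :: real and Lm Dm p :: "nat \<Rightarrow> real"
    and M K :: nat
    and \<eta> :: "nat \<Rightarrow> 's \<Rightarrow> nat" and \<xi> :: "nat \<Rightarrow> 's \<Rightarrow> bool"
    and z zh w :: "nat \<Rightarrow> 's \<Rightarrow> 'a"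
  assumes "prob_space P"
    and "proper_fun h" and "lower_semicont h" and "convex_fun h"
    and "Z \<noteq> {}" and "closed Z" and "convex Z" and "edom h \<subseteq> Z"
    and "0 \<le> \<tau>" and "\<tau> < 1"
    and "VI_solution Z F h zs"
    and "compact C" and "C \<subseteq> Z" and "zs \<in> C"
    and "\<And>x. F x = (\<Sum>m=1..M. Fm m x)"
    and "\<And>m. m \<in> {1..M} \<Longrightarrow> boundedly_Lipschitz_on Z (Fm m) (Lm m) (Dm m)"
    and "boundedly_Lipschitz_on Z F L D"
    and "\<And>m. m \<in> {1..M} \<Longrightarrow> p m > 0"
    and "(\<Sum>m=1..M. p m) = 1"
    and "K \<ge> 1" and "z0 \<in> Z" and "\<gamma> > 0"
    and "random_choices P K M p \<tau> \<eta> \<xi>"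
    and "extragradient_IS P K p \<tau> \<gamma> h F Fm z0 \<eta> \<xi> z zh w"
  shows
    "(\<forall>\<mu>F \<mu>h :: real.
        \<mu>F \<ge> 0 \<longrightarrow> \<mu>h \<ge> 0 \<longrightarrow> \<mu>F + \<mu>h > 0 \<longrightarrow>
        strong_monotonicity Z F h \<mu>F \<mu>h \<longrightarrow>
        ereal \<gamma> \<le> min
          (ereal (sqrt (1 - \<tau>)) / ereal (2 * sqrt 2 * sqrt (\<Sum>m=1..M. (Lm m)\<^sup>2 / p m)))
          (ereal ((1 - \<tau>) / (4 * (\<mu>F + \<mu>h)))) \<longrightarrow>
        integrable P (\<lambda>\<omega>. \<tau> * (norm (z K \<omega> - zs))\<^sup>2 + (norm (w K \<omega> - zs))\<^sup>2) \<and>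
        (\<integral>\<omega>. \<tau> * (norm (z K \<omega> - zs))\<^sup>2 + (norm (w K \<omega> - zs))\<^sup>2 \<partial>P)
          \<le> (1 - \<gamma> * ((\<mu>F + \<mu>h) / 16)) ^ (K - 1)
               * (\<tau> * (norm (z0 - zs))\<^sup>2 + (norm (z0 - zs))\<^sup>2)
             + 32 * \<gamma> / (\<mu>F + \<mu>h) * (\<Sum>m=1..M. (Dm m)\<^sup>2 / p m))
     \<and>
     (let zhat = (\<lambda>\<omega>. (1 / real K) *\<^sub>R (\<Sum>k<K. zh k \<omega>)) in
        strong_monotonicity Z F h 0 0 \<longrightarrow>
        ereal \<gamma> \<le> ereal (sqrt (1 - \<tau>))
          / ereal (2 * sqrt (2 * L\<^sup>2 + 4 * (\<Sum>m=1..M. (Lm m)\<^sup>2 / p m))) \<longrightarrow>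
        (AE \<omega> in P. \<bar>Gap C F h (zhat \<omega>)\<bar> \<noteq> \<infinity>) \<and>
        integrable P (\<lambda>\<omega>. real_of_ereal (Gap C F h (zhat \<omega>))) \<and>
        (\<integral>\<omega>. real_of_ereal (Gap C F h (zhat \<omega>)) \<partial>P)
          \<le> 8 * (SUP u\<in>C. (norm (z0 - u))\<^sup>2) / (\<gamma> * real K)
             + \<gamma> * (9 * (\<Sum>m=1..M. (Dm m)\<^sup>2 / p m) + 2 * D\<^sup>2))"
proof -
  note P = assms(1) and sol = assms(11) and z0 = assms(21)
    and choices = assms(23) and IS = assms(24) and C = assms(12,14) and K = assms(20)
  interpret extragradient_problem h F Fm Z M p Lm Dm \<tau> \<gamma>
    by unfold_locales (use assms in auto)
  have \<tau>1: "0 < 1 - \<tau>" using \<tau> by simp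
  let ?S = "\<Sum>m=1..M. (Lm m)\<^sup>2 / p m" and ?D = "\<Sum>m=1..M. (Dm m)\<^sup>2 / p m"
  have sums: "?S = Lip2" "?D = Dev2" by (simp_all add: Lip2_def Dev2_def)
  show ?thesis
    unfolding Let_def sums
  proof (intro conjI allI impI)
    fix \<mu>F \<mu>h :: real
    assume \<mu>: "0 \<le> \<mu>F" "0 \<le> \<mu>h" "0 < \<mu>F + \<mu>h" and sm: "strong_monotonicity Z F h \<mu>F \<mu>h"
      and le: "ereal \<gamma> \<le> min (ereal (sqrt (1 - \<tau>)) / ereal (2 * sqrt 2 * sqrt Lip2))
          (ereal ((1 - \<tau>) / (4 * (\<mu>F + \<mu>h))))"
    have \<gamma>L: "8 * \<gamma>\<^sup>2 * Lip2 \<le> 1 - \<tau>"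
      using ereal_stepsize_bound[of \<gamma> "1 - \<tau>" "2 * sqrt 2 * sqrt Lip2"] le \<gamma> \<tau>1 Lip2_nonneg
      by (simp add: power_mult_distrib)
    have \<gamma>\<mu>: "4 * \<gamma> * (\<mu>F + \<mu>h) \<le> 1 - \<tau>"
      using le \<mu>(3) by (simp add: pos_le_divide_eq mult.commute mult.left_commute)
    note conv = strongly_monotone_convergence[OF P sol z0 choices IS sm \<mu> \<gamma>L \<gamma>\<mu>]
    show "integrable P (\<lambda>\<omega>. \<tau> * (norm (z K \<omega> - zs))\<^sup>2 + (norm (w K \<omega> - zs))\<^sup>2)"
      by (rule conv(1))
    let ?a = "1 - \<gamma> * ((\<mu>F + \<mu>h) / 16)"
    \<comment> \<open>All K steps contract; since the factor lies between 0 and 1, the exponent K -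
      1 gives a weaker bound.\<close>
    have "?a ^ K \<le> ?a ^ (K - 1)"
      using \<gamma>\<mu> \<gamma> \<mu> \<tau> by (intro power_decreasing) auto
    then have "?a ^ K * Lyapunov zs (z0, z0) \<le> ?a ^ (K - 1) * Lyapunov zs (z0, z0)"
      using \<tau> by (intro mult_right_mono) (auto simp: Lyapunov_def)
    with conv(2) show "(\<integral>\<omega>. \<tau> * (norm (z K \<omega> - zs))\<^sup>2 + (norm (w K \<omega> - zs))\<^sup>2 \<partial>P)
      \<le> ?a ^ (K - 1) * (\<tau> * (norm (z0 - zs))\<^sup>2 + (norm (z0 - zs))\<^sup>2) + 32 * \<gamma> / (\<mu>F + \<mu>h) * Dev2"
      by (simp add: Lyapunov_def)
  next
    assume mono: "strong_monotonicity Z F h 0 0"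
      and le: "ereal \<gamma> \<le> ereal (sqrt (1 - \<tau>)) / ereal (2 * sqrt (2 * L\<^sup>2 + 4 * Lip2))"
    \<comment> \<open>The squared step size condition reads 8 \<gamma>^2 L^2 + 16 \<gamma>^2
      \<open>Lip2\<close> \<le> 1 - \<tau>, which contains the bound needed to absorb the
      noise.\<close>
    have "4 * \<gamma>\<^sup>2 * (2 * L\<^sup>2 + 4 * Lip2) \<le> 1 - \<tau>"
      using ereal_stepsize_bound[OF le \<gamma> \<tau>1] Lip2_nonneg by (simp add: power_mult_distrib algebra_simps)
    moreover have "0 \<le> \<gamma>\<^sup>2 * L\<^sup>2" by simp
    ultimately have \<gamma>L: "16 * \<gamma>\<^sup>2 * Lip2 \<le> 1 - \<tau>"
      unfolding distrib_left by linarith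
    note conv = monotone_gap_convergence[OF P sol z0 choices IS K C mono \<gamma>L]
    show "AE \<omega> in P. \<bar>Gap C F h ((1 / real K) *\<^sub>R (\<Sum>k<K. zh k \<omega>))\<bar> \<noteq> \<infinity>"
      by (rule AE_I2) (rule conv(1))
    show "integrable P (\<lambda>\<omega>. real_of_ereal (Gap C F h ((1 / real K) *\<^sub>R (\<Sum>k<K. zh k \<omega>))))"
      by (rule conv(2))
    let ?R = "SUP u\<in>C. (norm (z0 - u))\<^sup>2"
    have "bdd_above ((\<lambda>u. (norm (z0 - u))\<^sup>2) ` C)"
      by (intro bounded_imp_bdd_above compact_imp_bounded compact_continuous_image C(1) continuous_intros)
    then have "0 \<le> ?R"
      by (rule cSUP_upper2[OF _ C(2)]) simp
    then have "3 * ?R / (\<gamma> * real K) \<le> 8 * ?R / (\<gamma> * real K)"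
      using \<gamma> by (intro divide_right_mono) auto
    moreover have "9 / 8 * \<gamma> * Dev2 = \<gamma> * (9 / 8 * Dev2)" by simp
    moreover have "\<gamma> * (9 / 8 * Dev2) \<le> \<gamma> * (9 * Dev2 + 2 * D\<^sup>2)"
    proof (rule mult_left_mono)
      have "0 \<le> D\<^sup>2" by simp
      then show "9 / 8 * Dev2 \<le> 9 * Dev2 + 2 * D\<^sup>2" using Dev2_nonneg by linarith
    qed (use \<gamma> in simp)
    ultimately show "(\<integral>\<omega>. real_of_ereal (Gap C F h ((1 / real K) *\<^sub>R (\<Sum>k<K. zh k \<omega>))) \<partial>P)
      \<le> 8 * ?R / (\<gamma> * real K) + \<gamma> * (9 * Dev2 + 2 * D\<^sup>2)"
      using conv(3) by linarith
  qed
qed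

end
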